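(* Let $\mathcal G=(\mathcal G_k)_{k\ge 2}$, where $\mathcal G_k$ is the property that a finite group presentation on the generators $a_1,\dots,a_k$ defines a group $G$ such that every proper subset of $\{a_1,\dots,a_k\}$ freely generates a free subgroup of $G$. Then $\mathcal G$ is monotone low-density random but not $d$-random for any $d>0$.
   Context: Let $\mathcal C_k$ be the set of all cyclically reduced words in the free group $F(a_1,\dots,a_k)$ and $\gamma(n,\mathcal C_k)$ the number of words of length $n$ in $\mathcal C_k$. Let $\mathcal G=(\mathcal G_k)_{k\ge2}$ be a property of finite presentations, $\mathcal G_k$ being a property of presentations on $a_1,\dots,a_k$. For a sequence $(d(k))_{k\ge 2}$ with $0<d(k)<1$, $\mathcal G$ is low-density random with density sequence $(d(k))_{k\ge2}$ if for every $k\ge 2$ $$\lim_{n\to\infty}\frac{R_k(n,d(k),\mathcal G_k)}{\gamma(n,\mathcal C_k)^{m_n}}=1,$$ where $m_n=(2k-1)^{n d(k)}$ (rounded down to an integer) and $R_k(n,d(k),\mathcal G_k)$ is the number of $m_n$-tuples $(r_1,\dots,r_{m_n})$ of cyclically reduced words of length $n$ such that the presentation $\langle a_1,\dots,a_k\mid r_1,\dots,r_{m_n}\rangle$ has property $\mathcal G_k$. $\mathcal G$ is monotone low-density random if there is a sequence $(d(k))_{k\ge2}$ with $0<d(k)<1$ such that $\mathcal G$ is low-density random with density sequence $(d'(k))_{k\ge 2}$ whenever $0<d'(k)\le d(k)$ for all $k$. For $0<d<1$ (independent of $k$), $\mathcal G$ is $d$-random if it is low-density random with the constant density sequence $d(k)=d$.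 *)

theory Defs
  imports Complex_Main "HOL-Algebra.Coset" "HOL-Algebra.Generated_Groups"
begin

section \<open>Free groups, as groups of reduced words\<close>

text \<open>The letter \<open>(x, True)\<close> stands for the generator \<open>x\<close>, and \<open>(x, False)\<close> for its inverse.\<close>

type_synonym 'a letter = "'a \<times> bool"
type_synonym 'a word = "'a letter list"

definition inv_letter :: "'a letter \<Rightarrow> 'a letter" where
  "inv_letter l = (fst l, \<not> snd l)"

definition reduced :: "'a word \<Rightarrow> bool" where
  "reduced w \<longleftrightarrow> successively (\<lambda>l l'. l' \<noteq> inv_letter l) w"

definition cyclically_reduced :: "'a word \<Rightarrow> bool" where
  "cyclically_reduced w \<longleftrightarrow> reduced w \<and> (w \<noteq> [] \<longrightarrow> hd w \<noteq> inv_letter (last w))"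

definition cons_reduce :: "'a letter \<Rightarrow> 'a word \<Rightarrow> 'a word" where
  "cons_reduce l w = (if w \<noteq> [] \<and> hd w = inv_letter l then tl w else l # w)"

definition reduce :: "'a word \<Rightarrow> 'a word" where
  "reduce w = foldr cons_reduce w []"

definition free_group :: "'a set \<Rightarrow> 'a word monoid" where
  "free_group X =
     \<lparr>carrier = {w. reduced w \<and> fst ` set w \<subseteq> X},
      mult = (\<lambda>u v. reduce (u @ v)),
      one = []\<rparr>"

lemma inv_letter_inv_letter [simp]: "inv_letter (inv_letter l) = l"
  by (simp add: inv_letter_def)

lemma fst_inv_letter [simp]: "fst (inv_letter l) = fst l"
  by (simp add: inv_letter_def)

lemma reduced_Nil [simp]: "reduced []"
  by (simp add: reduced_def)

lemma reduced_Cons: "reduced (l # w) \<longleftrightarrow> reduced w \<and> (w \<noteq> [] \<longrightarrow> hd w \<noteq> inv_letter l)"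
  by (auto simp: reduced_def successively_Cons)

lemma reduced_cons_reduce: "reduced w \<Longrightarrow> reduced (cons_reduce l w)"
  by (cases w) (auto simp: cons_reduce_def reduced_Cons)

lemma reduce_Nil [simp]: "reduce [] = []"
  by (simp add: reduce_def)

lemma reduce_Cons [simp]: "reduce (l # w) = cons_reduce l (reduce w)"
  by (simp add: reduce_def)

lemma reduced_reduce: "reduced (reduce w)"
  by (induction w) (auto intro: reduced_cons_reduce)

lemma reduce_reduced: "reduced w \<Longrightarrow> reduce w = w"
  by (induction w) (auto simp: reduced_Cons cons_reduce_def)

lemma letters_reduce: "set (reduce w) \<subseteq> set w"
proof (induction w)
  case (Cons l w)
  then show ?case
    by (cases "reduce w") (auto simp: cons_reduce_def)
qed simp

lemma cons_reduce_cancel: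
  assumes "reduced w"
  shows "cons_reduce l (cons_reduce (inv_letter l) w) = w"
  using assms
  by (cases w; cases "tl w") (auto simp: cons_reduce_def reduced_Cons)

lemma reduce_append_right: "reduce (u @ reduce v) = reduce (u @ v)"
  by (induction u) (auto simp: reduce_reduced reduced_reduce)

lemma reduce_cons_reduce_append: "reduce (cons_reduce l u @ v) = cons_reduce l (reduce (u @ v))"
proof (cases "u \<noteq> [] \<and> hd u = inv_letter l")
  case True
  then obtain u' where u: "u = inv_letter l # u'"
    by (cases u) auto
  then show ?thesis
    by (simp add: cons_reduce_def[of l "inv_letter l # u'"] cons_reduce_cancel reduced_reduce)
next
  case False
  then have "cons_reduce l u = l # u"
    by (auto simp: cons_reduce_def)
  then show ?thesis
    by simp
qed

lemma reduce_append_left: "reduce (reduce u @ v) = reduce (u @ v)"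
  by (induction u) (simp_all add: reduce_cons_reduce_append)

lemma reduce_inverse_append: "reduce (rev (map inv_letter w) @ w) = []"
proof (induction w)
  case (Cons l w)
  have "reduce (inv_letter l # l # w) = reduce w"
    using cons_reduce_cancel[of "reduce w" "inv_letter l"] by (simp add: reduced_reduce)
  then have "reduce (rev (map inv_letter w) @ inv_letter l # l # w) =
      reduce (rev (map inv_letter w) @ w)"
    by (metis reduce_append_right)
  then show ?case
    using Cons by simp
qed simp

lemma group_free_group: "group (free_group X)"
proof (rule groupI)
  fix u v
  assume "u \<in> carrier (free_group X)" "v \<in> carrier (free_group X)"
  then show "u \<otimes>\<^bsub>free_group X\<^esub> v \<in> carrier (free_group X)"
    using letters_reduce[of "u @ v"] by (fastforce simp: free_group_def reduced_reduce)
next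
  fix u
  assume u: "u \<in> carrier (free_group X)"
  let ?v = "reduce (rev (map inv_letter u))"
  have "?v \<in> carrier (free_group X)"
    using u letters_reduce[of "rev (map inv_letter u)"]
    by (fastforce simp: free_group_def reduced_reduce)
  moreover have "?v \<otimes>\<^bsub>free_group X\<^esub> u = \<one>\<^bsub>free_group X\<^esub>"
    by (simp add: free_group_def reduce_append_left reduce_inverse_append)
  ultimately show "\<exists>v\<in>carrier (free_group X). v \<otimes>\<^bsub>free_group X\<^esub> u = \<one>\<^bsub>free_group X\<^esub>"
    by blast
qed (auto simp: free_group_def reduce_append_left reduce_append_right reduce_reduced)


section \<open>Group presentations\<close>

definition normal_closure :: "('g, 'm) monoid_scheme \<Rightarrow> 'g set \<Rightarrow> 'g set" where
  "normal_closure G S = \<Inter> {N. N \<lhd> G \<and> S \<subseteq> N}"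

text \<open>The relators are meant to be reduced words over \<open>X\<close>, that is, elements of the free group.\<close>

definition presented_group :: "'a set \<Rightarrow> 'a word list \<Rightarrow> 'a word set monoid" where
  "presented_group X rs = free_group X Mod normal_closure (free_group X) (set rs)"

definition presented_gen :: "'a set \<Rightarrow> 'a word list \<Rightarrow> 'a \<Rightarrow> 'a word set" where
  "presented_gen X rs x =
     normal_closure (free_group X) (set rs) #>\<^bsub>free_group X\<^esub> [(x, True)]"

lemma (in group) normal_normal_closure:
  assumes "S \<subseteq> carrier G"
  shows "normal_closure G S \<lhd> G"
proof -
  have carr: "carrier G \<lhd> G"
    by (rule normal_invI) (auto simp: subgroup_self)
  have "subgroup (normal_closure G S) G"
    unfolding normal_closure_def
    using carr assms by (intro subgroups_Inter) (auto simp: normal_def)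
  moreover have "x \<otimes> h \<otimes> inv x \<in> normal_closure G S"
    if "x \<in> carrier G" "h \<in> normal_closure G S" for x h
    using that by (auto simp: normal_closure_def intro: normal.inv_op_closed2)
  ultimately show ?thesis
    by (intro normal_invI) auto
qed

lemma group_presented_group:
  assumes "set rs \<subseteq> carrier (free_group X)"
  shows "group (presented_group X rs)"
  unfolding presented_group_def
  by (intro normal.factorgroup_is_group group.normal_normal_closure group_free_group assms)


section \<open>Free generation\<close>

definition word_value :: "('g, 'm) monoid_scheme \<Rightarrow> ('a \<Rightarrow> 'g) \<Rightarrow> 'a word \<Rightarrow> 'g" where
  "word_value G f w =
     foldr (\<lambda>l g. (if snd l then f (fst l) else inv\<^bsub>G\<^esub> (f (fst l))) \<otimes>\<^bsub>G\<^esub> g) w \<one>\<^bsub>G\<^esub>"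

text \<open>
  The family \<open>f\<close>, indexed by \<open>X\<close>, freely generates a free subgroup of \<open>G\<close>: the canonical map
  from the free group on \<open>X\<close> to the subgroup generated by the family is an isomorphism. Distinct
  indices count as distinct generators, so a family with repetitions is not free.
\<close>

definition freely_generates :: "('g, 'm) monoid_scheme \<Rightarrow> ('a \<Rightarrow> 'g) \<Rightarrow> 'a set \<Rightarrow> bool" where
  "freely_generates G f X \<longleftrightarrow>
     word_value G f \<in> iso (free_group X) (G\<lparr>carrier := generate G (f ` X)\<rparr>)"


section \<open>Low-density random properties\<close>

text \<open>
  The generators \<open>a\<^sub>1, \<dots>, a\<^sub>k\<close> are the numbers \<open>1, \<dots>, k\<close>. A property of finite presentations is a
  predicate \<open>P\<close> where \<open>P k rs\<close> says that the presentation with generators \<open>a\<^sub>1, \<dots>, a\<^sub>k\<close> and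
  relators \<open>rs\<close> has the property.
\<close>

definition cyclically_reduced_words :: "nat \<Rightarrow> nat word set" where
  "cyclically_reduced_words k = {w \<in> carrier (free_group {1..k}). cyclically_reduced w}"

definition num_words :: "nat \<Rightarrow> nat word set \<Rightarrow> nat" where
  "num_words n C = card {w \<in> C. length w = n}"

definition num_relators :: "nat \<Rightarrow> nat \<Rightarrow> real \<Rightarrow> nat" where
  "num_relators k n d = nat \<lfloor>(2 * real k - 1) powr (real n * d)\<rfloor>"

definition num_presentations :: "nat \<Rightarrow> nat \<Rightarrow> real \<Rightarrow> (nat word list \<Rightarrow> bool) \<Rightarrow> nat" where
  "num_presentations k n d P =
     card {rs. length rs = num_relators k n d \<and>
               set rs \<subseteq> {w \<in> cyclically_reduced_words k. length w = n} \<and> P rs}"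

definition low_density_random ::
    "(nat \<Rightarrow> nat word list \<Rightarrow> bool) \<Rightarrow> (nat \<Rightarrow> real) \<Rightarrow> bool" where
  "low_density_random P d \<longleftrightarrow>
     (\<forall>k\<ge>2. (\<lambda>n. real (num_presentations k n (d k) (P k)) /
                 real (num_words n (cyclically_reduced_words k)) ^ num_relators k n (d k))
            \<longlonglongrightarrow> 1)"

definition monotone_low_density_random :: "(nat \<Rightarrow> nat word list \<Rightarrow> bool) \<Rightarrow> bool" where
  "monotone_low_density_random P \<longleftrightarrow>
     (\<exists>d. (\<forall>k\<ge>2. 0 < d k \<and> d k < 1) \<and>
          (\<forall>d'. (\<forall>k\<ge>2. 0 < d' k \<and> d' k \<le> d k) \<longrightarrow> low_density_random P d'))"

definition density_random :: "real \<Rightarrow> (nat \<Rightarrow> nat word list \<Rightarrow> bool) \<Rightarrow> bool" where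
  "density_random d P \<longleftrightarrow> low_density_random P (\<lambda>k. d)"

definition proper_subsets_free :: "nat \<Rightarrow> nat word list \<Rightarrow> bool" where
  "proper_subsets_free k rs \<longleftrightarrow>
     (\<forall>S. S \<subset> {1..k} \<longrightarrow>
        freely_generates (presented_group {1..k} rs) (presented_gen {1..k} rs) S)"

end

theory Submission
  imports Defs
begin

text \<open>
  Freeness is proved by small cancellation. A nonempty reduced word over a proper subset of the
  generators that is trivial in the group is the free reduction of a word obtained from the empty
  word by inserting relators and pairs \<open>x x\<inverse>\<close>. In such a word with the fewest relators, and
  then the fewest pairs, no pairs are left after passing to a subword, and the inserted
  \<open>N\<close> relators of length \<open>n\<close> split into at most \<open>2 N\<close> blocks. If two relators share only pieces shorter than
  \<open>\<epsilon>\<close>, every maximal cancellation between blocks is shorter than \<open>\<epsilon>\<close>, so that at least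
  \<open>N n - 8 \<epsilon> N\<close> letters survive beyond an allowance of \<open>2 \<epsilon>\<close> per surviving block.
  For \<open>8 \<epsilon> < n\<close> some block of length at least \<open>\<epsilon>\<close> therefore survives; at low
  density it contains every generator with probability tending to one.

  For a fixed density \<open>d\<close> and \<open>k\<close> so large that \<open>(2 k - 1)\<^sup>d \<ge> 4\<close>, some relator is a
  positive word in \<open>a\<^sub>1, \<dots>, a\<^sub>k\<^sub>-\<^sub>1\<close> with probability bounded away from zero.
\<close>


section \<open>Words and free reduction\<close>

text \<open>Words built by insertion play the role of van Kampen diagrams: nesting replaces
  planarity, and the pairs serve to conjugate. The obstacle is that the number of pairs is not
  bounded by the number of relators, so blocks cannot be counted while pairs are present. A pair
  that survives reduction encloses a factor of the reduced word, to which induction applies; any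
  other pair can be removed after moving the word that it encloses. Deleting two mutually inverse
  relators may create new pairs, hence the lexicographic order with relators first. The 8 in
  \<open>8 * \<epsilon> < n\<close> is two blocks per relator times \<open>4 * \<epsilon>\<close>
  per block: fewer than \<open>2 * \<epsilon>\<close> letters cancelled, and
  \<open>2 * \<epsilon>\<close> for a possible additional block. The event that sets the rate is a
  stretch of \<epsilon> letters omitting a generator: each letter after the first has 2k-3 choices
  instead of 2k-1. This quotient tends to 1 as k grows, so the admissible density shrinks with k;
  the negative half shows that it has to.\<close>

definition inv_word :: "'a word \<Rightarrow> 'a word" where
  "inv_word w = rev (map inv_letter w)"

lemma inv_word_Nil [simp]: "inv_word [] = []"
  by (simp add: inv_word_def)

lemma inv_word_append [simp]: "inv_word (u @ v) = inv_word v @ inv_word u"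
  by (simp add: inv_word_def)

lemma inv_word_Cons: "inv_word (l # w) = inv_word w @ [inv_letter l]"
  by (simp add: inv_word_def)

lemma inv_word_inv_word [simp]: "inv_word (inv_word w) = w"
  by (simp add: inv_word_def rev_map comp_def)

lemma length_inv_word [simp]: "length (inv_word w) = length w"
  by (simp add: inv_word_def)

lemma inv_word_eq_Nil_iff [simp]: "inv_word w = [] \<longleftrightarrow> w = []"
  by (simp add: inv_word_def)

lemma fst_set_inv_word [simp]: "fst ` set (inv_word w) = fst ` set w"
  by (force simp: inv_word_def)

lemma inv_letter_neq [simp]: "inv_letter l \<noteq> l" "l \<noteq> inv_letter l"
  by (auto simp: inv_letter_def prod_eq_iff)

lemma reduced_append:
  "reduced (u @ v) \<longleftrightarrow>
     reduced u \<and> reduced v \<and> (u \<noteq> [] \<longrightarrow> v \<noteq> [] \<longrightarrow> hd v \<noteq> inv_letter (last u))"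
  by (auto simp: reduced_def successively_append_iff)

lemma reduced_inv_word [simp]: "reduced (inv_word w) \<longleftrightarrow> reduced w"
proof -
  have "reduced (inv_word w)" if "reduced w" for w :: "'a word"
    using that
  proof (induction w)
    case (Cons l w)
    then show ?case
      by (cases w) (auto simp: inv_word_Cons reduced_append reduced_Cons)
  qed simp
  from this[of w] this[of "inv_word w"] show ?thesis
    by auto
qed

lemma reduce_append_cong:
  "reduce u = reduce u' \<Longrightarrow> reduce v = reduce v' \<Longrightarrow> reduce (u @ v) = reduce (u' @ v')"
  by (metis reduce_append_left reduce_append_right)

lemma reduce_append_trivial:
  assumes "reduce v = []"
  shows "reduce (u @ v @ w) = reduce (u @ w)"
  using reduce_append_cong[OF refl reduce_append_cong[OF _ refl, of v "[]" w]] assms by simp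

lemma reduce_inv_word_append [simp]: "reduce (inv_word w @ w) = []"
  by (simp add: inv_word_def reduce_inverse_append)

lemma reduce_append_inv_word [simp]: "reduce (w @ inv_word w) = []"
  using reduce_inv_word_append[of "inv_word w"] by simp

lemma reduce_inv_word: "reduce (inv_word w) = inv_word (reduce w)"
proof -
  have "reduce (inv_word w) = reduce ((inv_word (reduce w) @ reduce w) @ inv_word w)"
    using reduce_append_trivial[of "inv_word (reduce w) @ reduce w" "[]" "inv_word w"] by simp
  also have "\<dots> = reduce (inv_word (reduce w) @ (w @ inv_word w))"
    using reduce_append_cong[OF refl reduce_append_left[of w "inv_word w"]] by simp
  also have "\<dots> = reduce (inv_word (reduce w))"
    using reduce_append_trivial[of "w @ inv_word w" "inv_word (reduce w)" "[]"] by simp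
  finally show ?thesis
    by (simp add: reduce_reduced reduced_reduce)
qed

text \<open>A letter of the reduced form can be traced to an occurrence in the unreduced word before
  which everything cancels by itself. If the head of \<open>w\<close> is cancelled, its partner is
  found by induction, the trivial stretch up to the partner is dropped, and the search continues
  behind it.\<close>

lemma reduce_ConsE:
  assumes "reduce w = l # v"
  obtains w1 w2 where "w = w1 @ l # w2" "reduce w1 = []"
proof -
  have "\<exists>w1 w2. w = w1 @ l # w2 \<and> reduce w1 = []"
    using assms
  proof (induction w arbitrary: l v rule: length_induct)
    case (1 w)
    then obtain l' u where w: "w = l' # u"
      by (cases w) auto
    show ?case
    proof (cases "reduce u \<noteq> [] \<and> hd (reduce u) = inv_letter l'")
      case False
      then have "w = [] @ l # u"
        using 1(2) w by (auto simp: cons_reduce_def)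
      then show ?thesis
        using reduce_Nil by blast
    next
      case True
      then obtain v' where "reduce u = inv_letter l' # v'"
        by (cases "reduce u") auto
      moreover have "length u < length w"
        by (simp add: w)
      ultimately obtain u1 u2 where u: "u = u1 @ inv_letter l' # u2" "reduce u1 = []"
        using 1(1) by blast
      have triv: "reduce (l' # u1 @ [inv_letter l']) = []"
        using reduce_append_trivial[OF u(2), of "[l']" "[inv_letter l']"]
        by (simp add: cons_reduce_def)
      have "reduce u2 = l # v"
        using 1(2) reduce_append_trivial[OF triv, of "[]" u2] by (simp add: w u)
      moreover have "length u2 < length w"
        by (simp add: w u)
      ultimately obtain u3 u4 where u2: "u2 = u3 @ l # u4" "reduce u3 = []"
        using 1(1) by blast
      have "w = ((l' # u1 @ [inv_letter l']) @ u3) @ l # u4"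
        by (simp add: w u u2)
      moreover have "reduce ((l' # u1 @ [inv_letter l']) @ u3) = []"
        using reduce_append_trivial[OF triv, of "[]" u3] u2 by simp
      ultimately show ?thesis
        by blast
    qed
  qed
  with that show thesis
    by blast
qed

lemma reduce_snocE:
  assumes "reduce w = v @ [l]"
  obtains w1 w2 where "w = w1 @ l # w2" "reduce w2 = []"
proof -
  have "reduce (inv_word w) = inv_letter l # inv_word v"
    by (simp add: reduce_inv_word assms inv_word_Cons)
  then obtain u1 u2 where u: "inv_word w = u1 @ inv_letter l # u2" "reduce u1 = []"
    by (rule reduce_ConsE)
  have "w = inv_word (inv_word w)"
    by simp
  also have "\<dots> = inv_word u2 @ l # inv_word u1"
    unfolding u by (simp add: inv_word_Cons)
  finally show ?thesis
    using that u(2) by (simp add: reduce_inv_word)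
qed

text \<open>Free groups have no elements of order two: peeling off both ends leads to a single
  letter equal to its inverse, or to two adjacent inverse letters.\<close>

lemma inv_word_fixpoint:
  assumes "reduced w" "inv_word w = w"
  shows "w = []"
  using assms
proof (induction w rule: length_induct)
  case (1 w)
  show ?case
  proof (cases w)
    case (Cons l u)
    show ?thesis
    proof (cases u rule: rev_cases)
      case Nil
      with 1 Cons show ?thesis by (simp add: inv_word_Cons)
    next
      case (snoc v l')
      with 1 Cons have v: "reduced v" "inv_word v = v" "l = inv_letter l'"
        by (auto simp: inv_word_Cons reduced_Cons reduced_append)
      then have "v = []"
        using 1(1) Cons snoc by simp
      with 1(2) v(3) Cons snoc show ?thesis
        by (simp add: reduced_Cons)
    qed
  qed simp
qed

text \<open>Comparing lengths in \<open>inv_word u @ inv_word v = u @ v\<close> makes both factors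
  their own inverses. This is what prevents a relator from undergoing a long cancellation against
  itself.\<close>

lemma not_rotation_of_inverse:
  assumes "reduced (u @ v)" "inv_word (v @ u) = u @ v"
  shows "u @ v = []"
proof -
  have "inv_word u = u" "inv_word v = v"
    using assms(2) by (simp_all add: append_eq_append_conv)
  with assms(1) show ?thesis
    using inv_word_fixpoint by (fastforce simp: reduced_append)
qed


section \<open>Inserting relators and cancelling pairs\<close>

text \<open>\<open>N\<close> counts relators and \<open>M\<close> counts pairs; they are kept apart
  because the main induction is lexicographic in them. Insertion at arbitrary places yields products
  as well as, through nested pairs, conjugates.\<close>

inductive pattern :: "'a word set \<Rightarrow> 'a word \<Rightarrow> nat \<Rightarrow> nat \<Rightarrow> bool" for R where
  Nil: "pattern R [] 0 0"
| relator: "pattern R (A @ C) N M \<Longrightarrow> r \<in> R \<Longrightarrow> pattern R (A @ r @ C) (Suc N) M"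
| pair: "pattern R (A @ C) N M \<Longrightarrow> pattern R (A @ [x, inv_letter x] @ C) N (Suc M)"

lemma pattern_insert:
  assumes "pattern R B N' M'" "pattern R (A @ C) N M"
  shows "pattern R (A @ B @ C) (N + N') (M + M')"
  using assms
proof (induction rule: pattern.induct)
  case (relator A' C' N' M' r)
  then show ?case
    using pattern.relator[of R "A @ A'" "C' @ C"] by simp
next
  case (pair A' C' N' M' x)
  then show ?case
    using pattern.pair[of R "A @ A'" "C' @ C"] by simp
qed simp

lemma pattern_append:
  "pattern R U N M \<Longrightarrow> pattern R V N' M' \<Longrightarrow> pattern R (U @ V) (N + N') (M + M')"
  using pattern_insert[of R V N' M' U "[]" N M] by simp

lemma pattern_relator: "r \<in> R \<Longrightarrow> pattern R r 1 0"
  using pattern.relator[of R "[]" "[]" 0 0 r] by (simp add: pattern.Nil)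

lemma pattern_pair: "pattern R [x, inv_letter x] 0 1"
  using pattern.pair[of R "[]" "[]" 0 0 x] by (simp add: pattern.Nil)

lemma pattern_conjugate:
  assumes "pattern R W N M"
  shows "\<exists>M'. pattern R (u @ W @ inv_word u) N M'"
proof (induction u)
  case Nil
  then show ?case using assms by auto
next
  case (Cons x u)
  then obtain M' where "pattern R (u @ W @ inv_word u) N M'" by blast
  from pattern_insert[OF this, of "[x]" "[inv_letter x]" 0 1] pattern_pair[of R x]
  show ?case by (auto simp: inv_word_Cons)
qed

lemma pattern_inv_word:
  assumes "\<And>r. r \<in> R \<Longrightarrow> inv_word r \<in> R" "pattern R W N M"
  shows "pattern R (inv_word W) N M"
  using assms(2)
proof (induction rule: pattern.induct)
  case (relator A C N M r)
  then show ?case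
    using pattern.relator[of R "inv_word C" "inv_word A" N M "inv_word r"] assms(1) by simp
next
  case (pair A C N M x)
  then show ?case
    using pattern.pair[of R "inv_word C" "inv_word A" N M x] by (simp add: inv_word_Cons)
qed (simp add: pattern.Nil)

text \<open>The only interesting case is a cut inside the piece inserted last. There the roles are
  exchanged: the rotated rest \<open>C @ A\<close> is inserted into the rotated relator or the
  reversed pair.\<close>

lemma pattern_rotate:
  assumes rot: "\<And>u v. u @ v \<in> R \<Longrightarrow> v @ u \<in> R" and "pattern R (U @ V) N M"
  shows "pattern R (V @ U) N M"
  using assms(2)
proof (induction "U @ V" N M arbitrary: U V rule: pattern.induct)
  case Nil
  then show ?case by (simp add: pattern.Nil)
next
  case (relator A C N M r)
  from relator(4) consider
      (A) D where "A = U @ D" "V = D @ r @ C"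
    | (mid) r1 r2 where "r = r1 @ r2" "U = A @ r1" "V = r2 @ C"
    | (C) D where "U = A @ r @ D" "C = D @ V"
    by (auto simp: append_eq_append_conv2)
  then show ?case
  proof cases
    case A
    then show ?thesis
      using relator(2)[of U "D @ C"] relator(3) pattern.relator[of R D "C @ U" N M r] by simp
  next
    case mid
    have "pattern R (C @ A) N M"
      using relator(2)[of A C] by simp
    from pattern_insert[OF this, of r2 r1 1 0] show ?thesis
      using mid pattern_relator[of "r2 @ r1" R] rot relator(3) by simp
  next
    case C
    then show ?thesis
      using relator(2)[of "A @ D" V] relator(3) pattern.relator[of R "V @ A" D N M r] by simp
  qed
next
  case (pair A C N M x)
  from pair(3) consider
      (A) D where "A = U @ D" "V = D @ [x, inv_letter x] @ C"
    | (mid) "U = A @ [x]" "V = inv_letter x # C"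
    | (C) D where "U = A @ [x, inv_letter x] @ D" "C = D @ V"
    by (auto simp: append_eq_append_conv2 append_eq_Cons_conv Cons_eq_append_conv)
  then show ?case
  proof cases
    case A
    then show ?thesis
      using pair(2)[of U "D @ C"] pattern.pair[of R D "C @ U" N M x] by simp
  next
    case mid
    have "pattern R (C @ A) N M"
      using pair(2)[of A C] by simp
    from pattern_insert[OF this, of "[inv_letter x]" "[x]" 0 1] show ?thesis
      using mid pattern_pair[of R "inv_letter x"] by simp
  next
    case C
    then show ?thesis
      using pair(2)[of "A @ D" V] pattern.pair[of R "V @ A" D N M x] by simp
  qed
qed

text \<open>The pair found is the one inserted last. Only relators are inserted after it, and each
  lands to its left, inside it or to its right, so that inside and outside remain patterns
  separately.\<close>

lemma pattern_pairE:
  assumes "pattern R W N M" "M > 0"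
  obtains A x B C N1 M1 N2 M2 where
    "W = A @ x # B @ inv_letter x # C" "pattern R (A @ C) N1 M1" "pattern R B N2 M2"
    "N = N1 + N2" "M = Suc (M1 + M2)"
  using assms
proof (induction arbitrary: thesis rule: pattern.induct)
  case Nil
  then show ?case by simp
next
  case (pair A C N M x)
  show ?case
    using pair(3)[of A x "[]" C N M 0 0] pair(1) by (simp add: pattern.Nil)
next
  case (relator A' C' N M r)
  obtain A x B C N1 M1 N2 M2 where *:
    "A' @ C' = A @ x # B @ inv_letter x # C" "pattern R (A @ C) N1 M1" "pattern R B N2 M2"
    "N = N1 + N2" "M = Suc (M1 + M2)"
    using relator(3,5) by blast
  from *(1) consider
      (A) D where "A = A' @ D" "C' = D @ x # B @ inv_letter x # C"
    | (B) B1 B2 where "B = B1 @ B2" "A' = A @ x # B1" "C' = B2 @ inv_letter x # C"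
    | (C) D where "A' = A @ x # B @ inv_letter x # D" "C = D @ C'"
    by (auto simp: append_eq_append_conv2 append_eq_Cons_conv Cons_eq_append_conv)
  then show ?case
  proof cases
    case A
    then show ?thesis
      using relator(4)[of "A' @ r @ D" x B C "Suc N1" M1 N2 M2] * relator(2)
        pattern.relator[of R A' "D @ C" N1 M1 r] by simp
  next
    case B
    then show ?thesis
      using relator(4)[of A x "B1 @ r @ B2" C N1 M1 "Suc N2" M2] * relator(2)
        pattern.relator[of R B1 B2 N2 M2 r] by simp
  next
    case C
    then show ?thesis
      using relator(4)[of A x B "D @ r @ C'" "Suc N1" M1 N2 M2] * relator(2)
        pattern.relator[of R "A @ D" C' N1 M1 r] by simp
  qed
qed

locale symmetric_relators =
  fixes R :: "'a word set" and n :: nat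
  assumes length_relator: "r \<in> R \<Longrightarrow> length r = n"
    and reduced_relator: "r \<in> R \<Longrightarrow> reduced r"
    and rotate_relator: "u @ v \<in> R \<Longrightarrow> v @ u \<in> R"
    and inv_relator: "r \<in> R \<Longrightarrow> inv_word r \<in> R"
begin

text \<open>
  If a letter of an inserted pair cancels against another letter, then the word \<open>B\<close> that the pair
  encloses can be inserted elsewhere without the pair.
\<close>

lemma pattern_remove_pair:
  assumes AC: "pattern R (A @ C) N1 M1" and B: "pattern R B N2 M2"
    and red: "\<not> (reduce B \<noteq> [] \<and> reduced (reduce A @ x # reduce B @ inv_letter x # reduce C))"
  shows "\<exists>W. pattern R W (N1 + N2) (M1 + M2) \<and>
             reduce W = reduce (A @ x # B @ inv_letter x # C)"
proof -
  have xx: "reduce (x # [inv_letter x]) = []" "reduce (inv_letter x # [x]) = []"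
    by (auto simp: cons_reduce_def)
  consider (nil) "reduce B = []"
    | (a) "reduce A \<noteq> []" "last (reduce A) = inv_letter x"
    | (b1) "reduce B \<noteq> []" "hd (reduce B) = inv_letter x"
    | (b2) "reduce B \<noteq> []" "last (reduce B) = x"
    | (c) "reduce C \<noteq> []" "hd (reduce C) = x"
  proof -
    have "x \<noteq> inv_letter (last (reduce A))" if "last (reduce A) \<noteq> inv_letter x"
      using that by auto
    moreover have "inv_letter x \<noteq> inv_letter (last (reduce B))" if "last (reduce B) \<noteq> x"
      using that by (metis inv_letter_inv_letter)
    ultimately show thesis
      using red that reduced_reduce[of A] reduced_reduce[of B] reduced_reduce[of C]
      unfolding reduced_append reduced_Cons by (auto simp: hd_append split: if_splits)
  qed
  then show ?thesis
  proof cases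
    case nil
    have "reduce (A @ x # B @ inv_letter x # C) = reduce (A @ [x, inv_letter x] @ C)"
      using reduce_append_trivial[OF nil, of "A @ [x]" "inv_letter x # C"] by simp
    also have "\<dots> = reduce (A @ C)"
      by (rule reduce_append_trivial) (use xx in simp)
    also have "\<dots> = reduce (A @ B @ C)"
      using reduce_append_trivial[OF nil] by simp
    finally show ?thesis
      using pattern_insert[OF B AC] by metis
  next
    case a
    then have "reduce A = butlast (reduce A) @ [inv_letter x]"
      by (metis append_butlast_last_id)
    then obtain A1 A2 where A: "A = A1 @ inv_letter x # A2" "reduce A2 = []"
      by (rule reduce_snocE)
    \<comment> \<open>The \<open>inv_letter x\<close> in \<open>A\<close> that cancels the opening
      letter takes over the role of the closing letter, so \<open>B\<close> moves in front of it and
      the pair disappears. Case \<open>c\<close> is symmetric.\<close>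
    have "pattern R (A1 @ B @ inv_letter x # A2 @ C) (N1 + N2) (M1 + M2)"
      using pattern_insert[OF B, of A1 "inv_letter x # A2 @ C"] AC A by simp
    moreover have "reduce (A1 @ B @ inv_letter x # A2 @ C) = reduce (A1 @ B @ inv_letter x # C)"
      using reduce_append_trivial[OF A(2), of "A1 @ B @ [inv_letter x]" C] by simp
    moreover have "reduce (A @ x # B @ inv_letter x # C) =
        reduce (A1 @ [inv_letter x, x] @ B @ inv_letter x # C)"
      using reduce_append_trivial[OF A(2), of "A1 @ [inv_letter x]" "x # B @ inv_letter x # C"] A by simp
    moreover have "\<dots> = reduce (A1 @ B @ inv_letter x # C)"
      by (rule reduce_append_trivial) (use xx in simp)
    ultimately show ?thesis
      by metis
  next
    case c
    then have "reduce C = x # tl (reduce C)"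
      by (metis list.collapse)
    then obtain C1 C2 where C: "C = C1 @ x # C2" "reduce C1 = []"
      by (rule reduce_ConsE)
    have "pattern R ((A @ C1 @ [x]) @ B @ C2) (N1 + N2) (M1 + M2)"
      by (rule pattern_insert[OF B]) (use AC C in simp)
    moreover have "reduce ((A @ C1 @ [x]) @ B @ C2) = reduce (A @ x # B @ C2)"
      using reduce_append_trivial[OF C(2), of A "x # B @ C2"] by simp
    moreover have "reduce (A @ x # B @ inv_letter x # C) =
        reduce ((A @ x # B) @ [inv_letter x, x] @ C2)"
      using reduce_append_trivial[OF C(2), of "A @ x # B @ [inv_letter x]" "x # C2"] C by simp
    moreover have "\<dots> = reduce ((A @ x # B) @ C2)"
      by (rule reduce_append_trivial) (use xx in simp)
    ultimately show ?thesis
      by (metis append.assoc append_Cons)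
  next
    case b1
    then have "reduce B = inv_letter x # tl (reduce B)"
      by (metis list.collapse)
    then obtain B1 B2 where B': "B = B1 @ inv_letter x # B2" "reduce B1 = []"
      by (rule reduce_ConsE)
    \<comment> \<open>Here conjugating \<open>B\<close> by \<open>x\<close> only carries its first
      surviving letter to the end, which is a rotation; this is where closure of \<open>R\<close>
      under rotation enters. Case \<open>b2\<close> is symmetric.\<close>
    have "pattern R (B2 @ B1 @ [inv_letter x]) N2 M2"
      using pattern_rotate[OF rotate_relator, of "B1 @ [inv_letter x]" B2] B B' by simp
    from pattern_insert[OF this AC]
    have "pattern R (A @ (B2 @ B1 @ [inv_letter x]) @ C) (N1 + N2) (M1 + M2)" .
    moreover have "reduce (A @ (B2 @ B1 @ [inv_letter x]) @ C) = reduce (A @ B2 @ inv_letter x # C)"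
      using reduce_append_trivial[OF B'(2), of "A @ B2" "inv_letter x # C"] by simp
    moreover have "reduce (A @ x # B @ inv_letter x # C) =
        reduce (A @ [x, inv_letter x] @ B2 @ inv_letter x # C)"
      using reduce_append_trivial[OF B'(2), of "A @ [x]" "inv_letter x # B2 @ inv_letter x # C"] B'
      by simp
    moreover have "\<dots> = reduce (A @ B2 @ inv_letter x # C)"
      by (rule reduce_append_trivial) (use xx in simp)
    ultimately show ?thesis
      by metis
  next
    case b2
    then have "reduce B = butlast (reduce B) @ [x]"
      by (metis append_butlast_last_id)
    then obtain B1 B2 where B': "B = B1 @ x # B2" "reduce B2 = []"
      by (rule reduce_snocE)
    have "pattern R (x # B2 @ B1) N2 M2"
      using pattern_rotate[OF rotate_relator, of B1 "x # B2"] B B' by simp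
    from pattern_insert[OF this AC]
    have "pattern R (A @ (x # B2 @ B1) @ C) (N1 + N2) (M1 + M2)" .
    moreover have "reduce (A @ (x # B2 @ B1) @ C) = reduce (A @ x # B1 @ C)"
      using reduce_append_trivial[OF B'(2), of "A @ [x]" "B1 @ C"] by simp
    moreover have "reduce (A @ x # B @ inv_letter x # C) =
        reduce ((A @ x # B1) @ [x, inv_letter x] @ C)"
      using reduce_append_trivial[OF B'(2), of "A @ x # B1 @ [x]" "inv_letter x # C"] B' by simp
    moreover have "\<dots> = reduce ((A @ x # B1) @ C)"
      by (rule reduce_append_trivial) (use xx in simp)
    ultimately show ?thesis
      by (metis append.assoc append_Cons)
  qed
qed

end


section \<open>Cancellation between tagged relators\<close>

text \<open>The tag \<open>(i, s)\<close> stands for the \<open>s\<close>-th letter of the \<open>i\<close>-th relator that is inserted.\<close>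

type_synonym tag = "nat \<times> nat"

text \<open>A pattern without pairs, with names in place of letters. The names are distinct, so it
  stays known after cancellations which letter of which relator survives, and a single occurrence
  can be replaced.\<close>

inductive tagged :: "nat \<Rightarrow> tag list \<Rightarrow> nat \<Rightarrow> bool" for n where
  "tagged n [] 0"
| "tagged n (A @ C) N \<Longrightarrow> tagged n (A @ map (Pair N) [0..<n] @ C) (Suc N)"

definition tag_letter :: "(nat \<Rightarrow> 'a word) \<Rightarrow> tag \<Rightarrow> 'a letter" where
  "tag_letter f t = f (fst t) ! snd t"

definition run :: "nat \<Rightarrow> nat \<Rightarrow> tag list \<Rightarrow> bool" where
  "run n N b \<longleftrightarrow> (\<exists>i s e. i < N \<and> s \<le> e \<and> e \<le> n \<and> b = map (Pair i) [s..<e])"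

lemma run_take_drop:
  assumes "run n N b"
  shows "run n N (take k b)" "run n N (drop k b)"
proof -
  obtain i s e where b: "i < N" "s \<le> e" "e \<le> n" "b = map (Pair i) [s..<e]"
    using assms unfolding run_def by blast
  have "take k b = map (Pair i) [s..<min (s + k) e]" "drop k b = map (Pair i) [min (s + k) e..<e]"
    using b(2,4) by (auto simp: take_map drop_map min_def)
  with b show "run n N (take k b)" "run n N (drop k b)"
    unfolding run_def by (metis min.cobounded2 min.boundedI le_add1 le_trans order_refl)+
qed

lemma run_append: "run n N (x @ y) \<Longrightarrow> run n N x \<and> run n N y"
  using run_take_drop[of n N "x @ y" "length x"] by simp

lemma run_mono: "run n N b \<Longrightarrow> N \<le> N' \<Longrightarrow> run n N' b"
  unfolding run_def using order.strict_trans2 by blast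

lemma map_tag_letter_run:
  assumes "length (f i) = n" "e \<le> n"
  shows "map (tag_letter f) (map (Pair i) [s..<e]) = take (e - s) (drop s (f i))"
  using assms by (intro nth_equalityI) (auto simp: tag_letter_def)

lemma tagged_set: "tagged n L N \<Longrightarrow> set L = {..<N} \<times> {..<n} \<and> distinct L"
proof (induction rule: tagged.induct)
  case (2 A C N)
  then have AC: "set A \<union> set C = {..<N} \<times> {..<n}" "distinct A" "distinct C" "set A \<inter> set C = {}"
    by auto
  have "set (A @ map (Pair N) [0..<n] @ C) = (set A \<union> set C) \<union> Pair N ` {..<n}"
    by auto
  also have "\<dots> = {..<Suc N} \<times> {..<n}"
    unfolding AC(1) by (auto simp: less_Suc_eq)
  finally have set: "set (A @ map (Pair N) [0..<n] @ C) = {..<Suc N} \<times> {..<n}" .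
  have "set (map (Pair N) [0..<n]) \<inter> (set A \<union> set C) = {}"
    unfolding AC(1) by auto
  moreover have "distinct (map (Pair N) [0..<n])"
    by (simp add: distinct_map inj_on_def)
  ultimately have "distinct (A @ map (Pair N) [0..<n] @ C)"
    using AC(2-4) by (simp only: distinct_append set_append) blast
  with set show ?case
    by blast
qed simp

lemma pattern_tagged:
  assumes "pattern R W N M" "M = 0" "\<And>r. r \<in> R \<Longrightarrow> length r = n"
  shows "\<exists>f L. tagged n L N \<and> W = map (tag_letter f) L \<and> (\<forall>i<N. f i \<in> R)"
  using assms(1,2)
proof (induction rule: pattern.induct)
  case Nil
  then show ?case
    using tagged.intros(1) by fastforce
next
  case (relator A C N M r)
  then obtain f L where L: "tagged n L N" "A @ C = map (tag_letter f) L" "\<forall>i<N. f i \<in> R"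
    by blast
  then obtain A' C' where AC: "L = A' @ C'" "A = map (tag_letter f) A'" "C = map (tag_letter f) C'"
    by (metis map_eq_append_conv)
  have eq: "map (tag_letter (f(N := r))) X = map (tag_letter f) X" if "set X \<subseteq> set L" for X
    using tagged_set[OF L(1)] that by (fastforce simp: tag_letter_def)
  have r: "map (tag_letter (f(N := r))) (map (Pair N) [0..<n]) = r"
    using map_tag_letter_run[of "f(N := r)" N n n 0] assms(3)[OF relator(2)] by simp
  have "A @ r @ C = map (tag_letter (f(N := r))) (A' @ map (Pair N) [0..<n] @ C')"
    using eq[of A'] eq[of C'] r AC by simp
  moreover have "tagged n (A' @ map (Pair N) [0..<n] @ C') (Suc N)"
    using L(1) AC(1) by (auto intro: tagged.intros)
  moreover have "\<forall>i<Suc N. (f(N := r)) i \<in> R"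
    using L(3) relator(2) by (auto simp: less_Suc_eq)
  ultimately show ?case
    by blast
qed simp

lemma concat_eq_appendE:
  assumes "concat bs = A @ C"
  obtains xs b c ys where "bs = xs @ (b @ c) # ys" "A = concat xs @ b" "C = c @ concat ys"
  | "A = []" "C = []" "bs = []"
  using assms
proof (induction bs arbitrary: A thesis)
  case Nil
  then show ?case by simp
next
  case (Cons x bs)
  show ?case
  proof (cases "length A \<le> length x")
    case True
    then obtain c where "x = A @ c" "C = c @ concat bs"
      using Cons(4) by (auto simp: append_eq_append_conv2)
    then show ?thesis
      using Cons(2)[of "[]" A c bs] by simp
  next
    case False
    then obtain A' where A': "A = x @ A'" "concat bs = A' @ C"
      using Cons(4) by (auto simp: append_eq_append_conv2)
    show ?thesis
    proof (rule Cons(1)[OF _ _ A'(2)])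
      fix xs b c ys
      assume "bs = xs @ (b @ c) # ys" "A' = concat xs @ b" "C = c @ concat ys"
      then show thesis
        using Cons(2)[of "x # xs" b c ys] A' by simp
    next
      assume "A' = []" "C = []" "bs = []"
      then show thesis
        using Cons(2)[of "[]" x "[]" "[]"] A' by simp
    qed
  qed
qed

text \<open>A new relator cuts at most one existing block in two and is itself one block, so each
  insertion adds at most two.\<close>

lemma tagged_runs:
  assumes "tagged n L N"
  shows "\<exists>bs. L = concat bs \<and> length bs \<le> 2 * N \<and> (\<forall>b\<in>set bs. run n N b)"
  using assms
proof (induction rule: tagged.induct)
  case 1
  then show ?case by simp
next
  case (2 A C N)
  have run: "run n (Suc N) (map (Pair N) [0..<n])"
    unfolding run_def by blast
  obtain bs where bs: "concat bs = A @ C" "length bs \<le> 2 * N" "\<forall>b\<in>set bs. run n N b"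
    using 2 by metis
  from bs(1) show ?case
  proof (cases rule: concat_eq_appendE)
    case (1 xs b c ys)
    then have "run n N b" "run n N c"
      using bs(3) run_append[of n N b c] by auto
    then have "\<forall>d\<in>set (xs @ [b, map (Pair N) [0..<n], c] @ ys). run n (Suc N) d"
      using bs(3) 1 run run_mono[of n N _ "Suc N"] by auto
    then show ?thesis
      using 1 bs(2) by (intro exI[of _ "xs @ [b, map (Pair N) [0..<n], c] @ ys"]) auto
  next
    case 2
    then show ?thesis
      using run by (intro exI[of _ "[map (Pair N) [0..<n]]"]) auto
  qed
qed

text \<open>Free reduction in single steps, stopped anywhere. Unlike \<open>reduce\<close>, it
  records which occurrences survive.\<close>

inductive cancel :: "(tag \<Rightarrow> 'a letter) \<Rightarrow> tag list \<Rightarrow> tag list \<Rightarrow> bool" for v where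
  cancel_refl: "cancel v L L"
| cancel_step: "cancel v L (P @ [t, t'] @ Q) \<Longrightarrow> v t' = inv_letter (v t) \<Longrightarrow> cancel v L (P @ Q)"

lemma cancel_set: "cancel v L Z \<Longrightarrow> set Z \<subseteq> set L \<and> (distinct L \<longrightarrow> distinct Z)"
  by (induction rule: cancel.induct) auto

lemma cancel_append:
  assumes "cancel v L (P @ a @ a' @ Q)" "map v a' = inv_word (map v a)"
  shows "cancel v L (P @ Q)"
  using assms
proof (induction a arbitrary: a' Q rule: rev_induct)
  case (snoc t a)
  then obtain t' b where "a' = t' # b" "v t' = inv_letter (v t)" "map v b = inv_word (map v a)"
    by (auto simp: inv_word_def)
  then show ?case
    using snoc(1)[of b Q] snoc(2) cancel.cancel_step[of v L "P @ a" t t' "b @ Q"] by simp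
qed simp

text \<open>Replacing letters by words is compatible with a cancellation as long as the replaced
  letters are not among the cancelled ones.\<close>

lemma cancel_reduce:
  assumes "cancel v L Z" "distinct L" "\<And>t. t \<in> set L - set Z \<Longrightarrow> \<phi> t = [v t]"
  shows "reduce (concat (map \<phi> L)) = reduce (concat (map \<phi> Z))"
  using assms
proof (induction rule: cancel.induct)
  case (cancel_step L P t t' Q)
  have "distinct (P @ [t, t'] @ Q)" "{t, t'} \<subseteq> set L"
    using cancel_set[OF cancel_step(1)] cancel_step(4) by auto
  then have "\<phi> t = [v t]" "\<phi> t' = [v t']"
    using cancel_step(5) by auto
  then have "reduce (\<phi> t @ \<phi> t') = []"
    by (simp add: cancel_step(2) cons_reduce_def)
  then have "reduce (concat (map \<phi> (P @ [t, t'] @ Q))) = reduce (concat (map \<phi> (P @ Q)))"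
    using reduce_append_trivial[of "\<phi> t @ \<phi> t'" "concat (map \<phi> P)" "concat (map \<phi> Q)"] by simp
  with cancel_step show ?case
    by auto
qed simp

lemma cancel_reduce_letters: "cancel v L Z \<Longrightarrow> distinct L \<Longrightarrow> reduce (map v L) = reduce (map v Z)"
  using cancel_reduce[of v L Z "\<lambda>t. [v t]"] by (simp add: concat_map_singleton)

text \<open>Relators with index in \<open>Q\<close> become trivial and drop out. Any other relator,
  inserted behind the prefix \<open>?A\<close>, is split off as a conjugate by \<open>?A\<close> in
  front of the rest. The conjugation costs an uncontrolled number of pairs, but no relators.\<close>

lemma tagged_substitute:
  assumes inv: "\<And>r. r \<in> R \<Longrightarrow> inv_word r \<in> R"
    and "tagged n L N"
    and "\<And>i. i < N \<Longrightarrow>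
      if i \<in> Q then reduce (concat (map \<phi> (map (Pair i) [0..<n]))) = []
      else concat (map \<phi> (map (Pair i) [0..<n])) \<in> R"
  shows "\<exists>W M. pattern R W (card ({..<N} - Q)) M \<and> reduce W = reduce (concat (map \<phi> L))"
  using assms(2,3)
proof (induction rule: tagged.induct)
  case 1
  then show ?case
    using pattern.Nil by (intro exI[of _ "[]"]) auto
next
  case (2 A C N)
  let ?w = "concat (map \<phi> (map (Pair N) [0..<n]))"
  let ?A = "concat (map \<phi> A)" and ?C = "concat (map \<phi> C)"
  obtain W M where W: "pattern R W (card ({..<N} - Q)) M" "reduce W = reduce (?A @ ?C)"
    using 2(2)[OF 2(3)] by auto
  show ?case
  proof (cases "N \<in> Q")
    case True
    have "reduce ?w = []"
      using 2(3)[of N] True by simp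
    from reduce_append_trivial[OF this, of ?A ?C]
    have "reduce (concat (map \<phi> (A @ map (Pair N) [0..<n] @ C))) = reduce (?A @ ?C)"
      by simp
    moreover have "{..<Suc N} - Q = {..<N} - Q"
      using True by (auto simp: less_Suc_eq)
    ultimately show ?thesis
      using W by metis
  next
    case False
    then have "?w \<in> R"
      using 2(3)[of N] by simp
    then obtain M' where M': "pattern R (?A @ ?w @ inv_word ?A) 1 M'"
      using pattern_conjugate[OF pattern_relator] by blast
    have "{..<Suc N} - Q = insert N ({..<N} - Q)"
      using False by (auto simp: less_Suc_eq)
    then have "card ({..<Suc N} - Q) = 1 + card ({..<N} - Q)"
      by simp
    moreover have "reduce ((?A @ ?w @ inv_word ?A) @ W) = reduce ((?A @ ?w @ inv_word ?A) @ ?A @ ?C)"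
      using W(2) by (intro reduce_append_cong) auto
    moreover have "\<dots> = reduce (concat (map \<phi> (A @ map (Pair N) [0..<n] @ C)))"
      using reduce_append_trivial[OF reduce_inv_word_append, of "?A @ ?w" ?A ?C] by simp
    ultimately show ?thesis
      using pattern_append[OF M' W(1)] by metis
  qed
qed

lemma rotations_of_equal:
  assumes "u @ v = u' @ v'"
  obtains x y where "v @ u = x @ y" "v' @ u' = y @ x"
proof -
  from assms consider d where "u = u' @ d" "v' = d @ v" | d where "u' = u @ d" "v = d @ v'"
    by (auto simp: append_eq_append_conv2)
  then show thesis
  proof cases
    case 1
    then show ?thesis
      using that[of "v @ u'" d] by simp
  next
    case 2
    then show ?thesis
      using that[of d "v' @ u"] by simp
  qed
qed

text \<open>Modulo the relator, its letter at \<open>p\<close> equals the inverse of the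
  complementary arc, read cyclically from \<open>Suc p\<close>. Putting this arc in place of the
  letter makes the relator freely trivial.\<close>

lemma complement_trivial:
  assumes w: "length (f i) = n" and p: "p < n"
    and \<phi>: "\<phi> (i, p) = inv_word (drop (Suc p) (f i) @ take p (f i))"
      "\<And>s. s \<noteq> p \<Longrightarrow> \<phi> (i, s) = [tag_letter f (i, s)]"
  shows "reduce (concat (map \<phi> (map (Pair i) [0..<n]))) = []"
proof -
  have letters: "concat (map \<phi> (map (Pair i) xs)) = map (tag_letter f) (map (Pair i) xs)"
    if "p \<notin> set xs" for xs
    using that by (induction xs) (auto simp: \<phi>(2))
  have "[0..<n] = [0..<p] @ [p] @ [Suc p..<n]"
    using p upt_add_eq_append[of 0 p "n - p"] by (simp add: upt_conv_Cons)
  then have "concat (map \<phi> (map (Pair i) [0..<n])) =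
      take p (f i) @ inv_word (take p (f i)) @ inv_word (drop (Suc p) (f i)) @ drop (Suc p) (f i)"
    using letters[of "[0..<p]"] letters[of "[Suc p..<n]"] p w
      map_tag_letter_run[of f i n p 0] map_tag_letter_run[of f i n n "Suc p"]
    by (simp add: \<phi>(1))
  then show ?thesis
    using reduce_append_trivial[OF reduce_append_inv_word, of "[]" "take p (f i)"] by simp
qed

lemma maximal_cancellation:
  fixes v :: "'t \<Rightarrow> 'a letter"
  shows "\<exists>x' a a' b'. x = x' @ a \<and> b = a' @ b' \<and> map v a' = inv_word (map v a) \<and>
       (x' \<noteq> [] \<longrightarrow> b' \<noteq> [] \<longrightarrow> v (hd b') \<noteq> inv_letter (v (last x')))"
proof (induction x arbitrary: b rule: rev_induct)
  case Nil
  then show ?case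
    by (intro exI[of _ "[]"] exI[of _ b]) simp
next
  case (snoc t x)
  show ?case
  proof (cases "b \<noteq> [] \<and> v (hd b) = inv_letter (v t)")
    case True
    then obtain t' c where b: "b = t' # c" "v t' = inv_letter (v t)"
      by (cases b) auto
    obtain x' a a' b' where *: "x = x' @ a" "c = a' @ b'" "map v a' = inv_word (map v a)"
      "x' \<noteq> [] \<longrightarrow> b' \<noteq> [] \<longrightarrow> v (hd b') \<noteq> inv_letter (v (last x'))"
      using snoc[of c] by blast
    have "x @ [t] = x' @ (a @ [t])" "b = (t' # a') @ b'"
      "map v (t' # a') = inv_word (map v (a @ [t]))"
      using * b by (simp_all add: inv_word_def)
    then show ?thesis
      using *(4) by blast
  next
    case False
    have "x @ [t] = (x @ [t]) @ []" "b = [] @ b" "map v [] = inv_word (map v [])"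
      by simp_all
    moreover have "b \<noteq> [] \<longrightarrow> v (hd b) \<noteq> inv_letter (v (last (x @ [t])))"
      using False by auto
    ultimately show ?thesis
      by blast
  qed
qed

text \<open>Appending a block \<open>b\<close> and cancelling raises this potential by at least \<open>length b - 4 \<epsilon>\<close>.\<close>

definition weight :: "nat \<Rightarrow> 'b list list \<Rightarrow> int" where
  "weight \<epsilon> bs = int (length (concat bs)) - 2 * int \<epsilon> * int (length bs)"

locale short_cancellations =
  fixes v :: "tag \<Rightarrow> 'a letter" and L :: "tag list" and n N \<epsilon> :: nat
  assumes reduced_run: "run n N b \<Longrightarrow> reduced (map v b)"
    and short: "cancel v L (P @ a @ a' @ Q) \<Longrightarrow> run n N a \<Longrightarrow> run n N a' \<Longrightarrow>
      map v a' = inv_word (map v a) \<Longrightarrow> length a < \<epsilon>"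
begin

definition reduced_runs :: "tag list list \<Rightarrow> bool" where
  "reduced_runs bs \<longleftrightarrow> (\<forall>b\<in>set bs. b \<noteq> [] \<and> run n N b) \<and> reduced (map v (concat bs))"

text \<open>If the cancellation stops inside the last block \<open>x\<close>, fewer than
  \<open>2 * \<epsilon>\<close> letters are lost and at most one block is added, at a price of
  \<open>2 * \<epsilon>\<close>. If it swallows \<open>x\<close>, the induction continues with the
  rest of \<open>b\<close>.\<close>

lemma append_run:
  assumes "cancel v L (concat bs @ b @ Q)" "reduced_runs bs" "run n N b"
  shows "\<exists>bs'. cancel v L (concat bs' @ Q) \<and> reduced_runs bs' \<and>
      weight \<epsilon> bs' \<ge> weight \<epsilon> bs + int (length b) - 4 * int \<epsilon>"
  using assms
proof (induction bs arbitrary: b rule: rev_induct)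
  case Nil
  then show ?case
    using reduced_run
    by (cases "b = []") (force simp: reduced_runs_def weight_def intro: exI[of _ "[]"] exI[of _ "[b]"])+
next
  case (snoc x bs)
  obtain x' a a' b' where *: "x = x' @ a" "b = a' @ b'" "map v a' = inv_word (map v a)"
      "x' \<noteq> [] \<Longrightarrow> b' \<noteq> [] \<Longrightarrow> v (hd b') \<noteq> inv_letter (v (last x'))"
    using maximal_cancellation[of x b v] by metis
  have runs: "run n N x'" "run n N a" "run n N a'" "run n N b'"
    using snoc(3,4) run_append[of n N x' a] run_append[of n N a' b'] *(1,2)
    by (auto simp: reduced_runs_def)
  have Z: "cancel v L ((concat bs @ x') @ a @ a' @ b' @ Q)"
    using snoc(2) * by simp
  have a: "length a < \<epsilon>" "length a' = length a"
    using short[OF Z runs(2,3) *(3)] arg_cong[OF *(3), of length] by simp_all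
  have Z': "cancel v L (concat bs @ x' @ b' @ Q)"
    using cancel_append[OF Z *(3)] by simp
  have red: "reduced_runs bs" "reduced (map v (concat bs @ x'))"
    using snoc(3) *(1) by (auto simp: reduced_runs_def reduced_append)
  show ?case
  proof (cases "x' = []")
    case True
    then obtain bs' where "cancel v L (concat bs' @ Q)" "reduced_runs bs'"
      "weight \<epsilon> bs' \<ge> weight \<epsilon> bs + int (length b') - 4 * int \<epsilon>"
      using snoc(1)[of b'] Z' red(1) runs(4) by auto
    \<comment> \<open>Losing the block \<open>x\<close> refunds \<open>2 * \<epsilon>\<close>, which
      pays for the \<open>2 * length a\<close> letters cancelled with it; so swallowing any number
      of blocks is free.\<close>
    moreover have "weight \<epsilon> bs = weight \<epsilon> (bs @ [x]) - int (length a) + 2 * int \<epsilon>"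
      using True *(1) by (simp add: weight_def algebra_simps)
    ultimately show ?thesis
      using a *(2) by (intro exI[of _ bs']) auto
  next
    case x': False
    show ?thesis
    proof (cases "b' = []")
      case True
      have "reduced_runs (bs @ [x'])"
        using red x' runs by (auto simp: reduced_runs_def)
      then show ?thesis
        using Z' True a * by (intro exI[of _ "bs @ [x']"]) (auto simp: weight_def algebra_simps)
    next
      case False
      have "reduced (map v (concat bs @ x') @ map v b')"
        using red(2) reduced_run[OF runs(4)] *(4)[OF x' False] x' False
        unfolding reduced_append by (auto simp: hd_map last_map)
      then have "reduced_runs (bs @ [x', b'])"
        using red(1) x' False runs by (auto simp: reduced_runs_def)
      then show ?thesis
        using Z' a * by (intro exI[of _ "bs @ [x', b']"]) (auto simp: weight_def algebra_simps)
    qed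
  qed
qed

lemma append_runs:
  assumes "cancel v L (concat bs @ concat cs)" "reduced_runs bs" "\<forall>c\<in>set cs. run n N c"
  shows "\<exists>bs'. cancel v L (concat bs') \<and> reduced_runs bs' \<and>
      weight \<epsilon> bs' \<ge> weight \<epsilon> bs + int (length (concat cs)) - 4 * int \<epsilon> * int (length cs)"
  using assms
proof (induction cs arbitrary: bs)
  case Nil
  then show ?case by auto
next
  case (Cons c cs)
  then obtain bs1 where "cancel v L (concat bs1 @ concat cs)" "reduced_runs bs1"
    "weight \<epsilon> bs1 \<ge> weight \<epsilon> bs + int (length c) - 4 * int \<epsilon>"
    using append_run[of bs c "concat cs"] by auto
  moreover obtain bs' where "cancel v L (concat bs')" "reduced_runs bs'"
     "weight \<epsilon> bs' \<ge> weight \<epsilon> bs1 + int (length (concat cs)) - 4 * int \<epsilon> * int (length cs)"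
    using Cons(1)[of bs1] Cons(4) calculation by auto
  ultimately show ?case
    by (intro exI[of _ bs']) (auto simp: algebra_simps)
qed

end


section \<open>Small cancellation\<close>

text \<open>Comparing prefixes suffices: \<open>R\<close> is closed under rotation, so every stretch
  of \<epsilon> letters of a cyclic relator is a prefix of an element of \<open>R\<close>.\<close>

locale small_cancellation = symmetric_relators R n for R :: "'a word set" and n +
  fixes \<epsilon> :: nat
  assumes piece: "r \<in> R \<Longrightarrow> r' \<in> R \<Longrightarrow> take \<epsilon> r = take \<epsilon> r' \<Longrightarrow> r = r'"
    and eps: "0 < \<epsilon>" "8 * \<epsilon> < n"
begin

text \<open>This property passes to factors of a word, as the treatment of surviving pairs requires,
  and it holds for words missing a generator once every such prefix contains all generators.\<close>

definition no_long_subword :: "'a word \<Rightarrow> bool" where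
  "no_long_subword w \<longleftrightarrow> (\<forall>r\<in>R. \<forall>p s. w \<noteq> p @ take \<epsilon> r @ s)"

text \<open>
  By the piece condition, a long cancellation makes the two relators mirror images of each other.
  Replacing a pair of cancelling letters by the inverses of the complementary arcs turns both
  relators into trivial words without changing the product.
\<close>

lemma remove_two_relators:
  assumes L: "tagged n L N" "\<forall>i<N. f i \<in> R"
    and Z: "cancel (tag_letter f) L (P @ a @ a' @ Q)" "run n N a" "run n N a'"
      "map (tag_letter f) a' = inv_word (map (tag_letter f) a)" "\<epsilon> \<le> length a"
  shows "\<exists>W N' M. N' < N \<and> pattern R W N' M \<and> reduce W = reduce (map (tag_letter f) L)"
proof -
  let ?v = "tag_letter f"
  obtain i s e where a: "i < N" "s \<le> e" "e \<le> n" "a = map (Pair i) [s..<e]"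
    using Z(2) unfolding run_def by blast
  obtain j q e' where a': "j < N" "q \<le> e'" "e' \<le> n" "a' = map (Pair j) [q..<e']"
    using Z(3) unfolding run_def by blast
  have len: "length a' = length a" "s < e" "q < e'"
    using arg_cong[OF Z(4), of length] Z(5) eps a(4) a'(4) by auto
  \<comment> \<open>Position of the last letter of \<open>a\<close>. It stands next to the first
    letter \<open>(j, q)\<close> of \<open>a'\<close>; neither of the two has been cancelled
    yet.\<close>
  define p where "p = e - 1"
  have p: "e = Suc p" "p < n" "q < n"
    using len a(3) a'(3) by (auto simp: p_def)
  have fi: "f i \<in> R" "length (f i) = n" and fj: "f j \<in> R" "length (f j) = n"
    using L(2) a(1) a'(1) length_relator by auto
  have va: "map ?v a = take (e - s) (drop s (f i))"
    unfolding a(4) by (rule map_tag_letter_run) (use fi a in auto)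
  have va': "map ?v a' = take (e' - q) (drop q (f j))"
    unfolding a'(4) by (rule map_tag_letter_run) (use fj a' in auto)
  \<comment> \<open>Both words begin with the letters of \<open>a'\<close>: the first is
    \<open>f j\<close> read from \<open>q\<close> onwards, the second is \<open>f i\<close> read
    backwards from the end of \<open>a\<close>. The piece condition makes them equal.\<close>
  let ?r1 = "drop q (f j) @ take q (f j)" and ?r2 = "inv_word (drop e (f i) @ take e (f i))"
  have R1: "?r1 \<in> R"
    by (rule rotate_relator) (simp add: fj)
  have R2: "?r2 \<in> R"
    by (rule inv_relator, rule rotate_relator) (simp add: fi)
  have "?r1 = map ?v a' @ drop (e' - q) (drop q (f j)) @ take q (f j)"
    unfolding va' append.assoc[symmetric] append_take_drop_id ..
  then have t1: "take \<epsilon> ?r1 = take \<epsilon> (map ?v a')"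
    using len Z(5) by simp
  have "take e (f i) = take s (f i) @ map ?v a"
    using va take_add[of s "e - s" "f i"] a(2) by simp
  then have "?r2 = map ?v a' @ inv_word (take s (f i)) @ inv_word (drop e (f i))"
    using Z(4) by simp
  then have "take \<epsilon> ?r2 = take \<epsilon> (map ?v a')"
    using len Z(5) by simp
  with t1 have r12: "?r1 = ?r2"
    using piece[OF R1 R2] by simp
  \<comment> \<open>Otherwise a relator would be a rotation of its own inverse.\<close>
  have "i \<noteq> j"
  proof
    assume "i = j"
    then obtain x y where xy: "drop e (f i) @ take e (f i) = x @ y" "?r1 = y @ x"
      using rotations_of_equal[of "take e (f i)" "drop e (f i)" "take q (f i)" "drop q (f i)"]
      by (metis append_take_drop_id)
    then have "y @ x = []"
      using not_rotation_of_inverse[of y x] reduced_relator[OF R1] r12 by metis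
    then show False
      using xy(2) p fj by simp
  qed
  define y where "y = drop (Suc p) (f i) @ take p (f i)"
  define y' where "y' = drop (Suc q) (f j) @ take q (f j)"
  have "?r1 = f j ! q # y'"
    using p fj Cons_nth_drop_Suc[of q "f j"] by (simp add: y'_def)
  moreover have "?r2 = inv_letter (f i ! p) # inv_word y"
    using p fi by (simp add: y_def take_Suc_conv_app_nth inv_word_Cons)
  ultimately have y': "y' = inv_word y"
    using r12 by simp
  \<comment> \<open>The two neighbouring letters become \<open>inv_word y\<close> and
    \<open>y\<close>, which still cancel, so the whole product is unchanged although both relators
    have become trivial.\<close>
  define \<phi> where "\<phi> = (\<lambda>t. [?v t])((i, p) := inv_word y, (j, q) := inv_word y')"
  define a0 where "a0 = map (Pair i) [s..<p]"
  define a0' where "a0' = map (Pair j) [Suc q..<e']"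
  define Z1 where "Z1 = P @ a0"
  define Z2 where "Z2 = a0' @ Q"
  have aeq: "a = a0 @ [(i, p)]" "a' = (j, q) # a0'"
    using a(4) a'(4) len p by (auto simp: a0_def a0'_def upt_conv_Cons)
  have Zeq: "P @ a @ a' @ Q = Z1 @ [(i, p), (j, q)] @ Z2"
    by (simp add: aeq Z1_def Z2_def)
  have dist: "distinct L"
    using tagged_set[OF L(1)] by blast
  then have "distinct (Z1 @ [(i, p), (j, q)] @ Z2)"
    using cancel_set[OF Z(1)] Zeq by simp
  then have notin: "(i, p) \<notin> set Z1 \<union> set Z2" "(j, q) \<notin> set Z1 \<union> set Z2"
    by auto
  have letters: "concat (map \<phi> X) = map ?v X" if "(i, p) \<notin> set X" "(j, q) \<notin> set X" for X
    using that by (induction X) (auto simp: \<phi>_def)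
  have "?v (j, q) = inv_letter (?v (i, p))"
    using Z(4) by (simp add: aeq inv_word_def)
  then have "reduce [?v (i, p), ?v (j, q)] = []"
    by (simp add: cons_reduce_def)
  then have L_Z: "reduce (map ?v L) = reduce (map ?v Z1 @ map ?v Z2)"
    using cancel_reduce_letters[OF Z(1) dist]
      reduce_append_trivial[of "[?v (i, p), ?v (j, q)]" "map ?v Z1" "map ?v Z2"] Zeq by simp
  have "reduce (concat (map \<phi> L)) = reduce (concat (map \<phi> (P @ a @ a' @ Q)))"
    by (rule cancel_reduce[OF Z(1) dist]) (auto simp: \<phi>_def aeq)
  also have "\<dots> = reduce (map ?v Z1 @ (inv_word y @ y) @ map ?v Z2)"
    unfolding Zeq using notin letters[of Z1] letters[of Z2] \<open>i \<noteq> j\<close> by (simp add: \<phi>_def y')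
  also have "\<dots> = reduce (map ?v L)"
    unfolding L_Z by (rule reduce_append_trivial) simp
  finally have \<phi>L: "reduce (concat (map \<phi> L)) = reduce (map ?v L)" .
  have "if k \<in> {i, j} then reduce (concat (map \<phi> (map (Pair k) [0..<n]))) = []
      else concat (map \<phi> (map (Pair k) [0..<n])) \<in> R" if "k < N" for k
  proof -
    have "reduce (concat (map \<phi> (map (Pair i) [0..<n]))) = []"
      by (rule complement_trivial[of f i n p]) (use fi p \<open>i \<noteq> j\<close> in \<open>auto simp: \<phi>_def y_def\<close>)
    moreover have "reduce (concat (map \<phi> (map (Pair j) [0..<n]))) = []"
      by (rule complement_trivial[of f j n q]) (use fj p \<open>i \<noteq> j\<close> in \<open>auto simp: \<phi>_def y'_def\<close>)
    moreover have "concat (map \<phi> (map (Pair k) [0..<n])) \<in> R" if "k \<notin> {i, j}"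
    proof -
      have "concat (map \<phi> (map (Pair k) [0..<n])) = map ?v (map (Pair k) [0..<n])"
        by (rule letters) (use that in auto)
      also have "\<dots> = f k"
        using map_tag_letter_run[of f k n n 0] L(2) \<open>k < N\<close> length_relator by simp
      finally show ?thesis
        using L(2) \<open>k < N\<close> by simp
    qed
    ultimately show ?thesis
      by auto
  qed
  from tagged_substitute[OF inv_relator L(1) this]
  obtain W M where "pattern R W (card ({..<N} - {i, j})) M" "reduce W = reduce (map ?v L)"
    using \<phi>L by metis
  moreover have "card ({..<N} - {i, j}) < N"
    using psubset_card_mono[of "{..<N}" "{..<N} - {i, j}"] a(1) by auto
  ultimately show ?thesis
    by blast
qed

text \<open>Each block is a stretch of one relator and hence shorter than \<epsilon>, too short to
  make up for the charge of \<open>2 * \<epsilon>\<close> per block.\<close>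

lemma no_long_subword_runs:
  assumes "\<forall>i<N. f i \<in> R" "\<forall>b\<in>set bs. run n N b"
    and "no_long_subword (map (tag_letter f) (concat bs))"
  shows "weight \<epsilon> bs \<le> 0"
proof -
  have "length b < \<epsilon>" if "b \<in> set bs" for b
  proof (rule ccontr)
    assume "\<not> length b < \<epsilon>"
    have "run n N b"
      using assms(2) that by blast
    then obtain i s e where b: "i < N" "s \<le> e" "e \<le> n" "b = map (Pair i) [s..<e]"
      unfolding run_def by blast
    let ?r = "drop s (f i) @ take s (f i)"
    have fi: "f i \<in> R" "length (f i) = n"
      using assms(1) b(1) length_relator by auto
    have R: "?r \<in> R"
      by (rule rotate_relator) (simp add: fi)
    have vb: "map (tag_letter f) b = take (e - s) (drop s (f i))"
      unfolding b(4) by (rule map_tag_letter_run) (use fi b in auto)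
    have "\<epsilon> \<le> e - s"
      using \<open>\<not> length b < \<epsilon>\<close> b(4) by simp
    then have "take \<epsilon> (map (tag_letter f) b) = take \<epsilon> ?r"
      using vb b(2,3) fi(2) by (simp add: min_def)
    then have "map (tag_letter f) b = take \<epsilon> ?r @ drop \<epsilon> (map (tag_letter f) b)"
      by (metis append_take_drop_id)
    moreover obtain xs ys where "bs = xs @ b # ys"
      using \<open>b \<in> set bs\<close> by (meson split_list)
    ultimately have "map (tag_letter f) (concat bs) = map (tag_letter f) (concat xs) @ take \<epsilon> ?r @
        (drop \<epsilon> (map (tag_letter f) b) @ map (tag_letter f) (concat ys))"
      by (metis append.assoc concat.simps(2) concat_append map_append)
    with assms(3) R show False
      unfolding no_long_subword_def by blast
  qed
  then have "length (concat bs) \<le> \<epsilon> * length bs"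
  proof (induction bs)
    case (Cons b bs)
    then have "length b \<le> \<epsilon>" "length (concat bs) \<le> \<epsilon> * length bs"
      by (auto simp: order.strict_implies_order)
    then show ?case
      by simp
  qed simp
  then have "int (length (concat bs)) \<le> int \<epsilon> * int (length bs)"
    by (metis of_nat_le_iff of_nat_mult)
  moreover have "0 \<le> int \<epsilon> * int (length bs)"
    by simp
  ultimately show ?thesis
    unfolding weight_def by linarith
qed

text \<open>Minimality excludes long cancellations through \<open>remove_two_relators\<close>. The
  potential of the surviving blocks is then at least \<open>N * n - 8 * \<epsilon> * N\<close> and
  at most 0, which leaves only \<open>N = 0\<close>.\<close>

lemma pattern_without_pairs:
  assumes "pattern R W N 0" "no_long_subword (reduce W)"
    and minimal: "\<And>W' N' M'. N' < N \<Longrightarrow> pattern R W' N' M' \<Longrightarrow> reduce W' \<noteq> reduce W"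
  shows "reduce W = []"
proof -
  obtain f L where L: "tagged n L N" "W = map (tag_letter f) L" "\<forall>i<N. f i \<in> R"
    using pattern_tagged[OF assms(1) refl] length_relator by blast
  interpret short_cancellations "tag_letter f" L n N \<epsilon>
  proof
    fix b
    assume "run n N b"
    then obtain i s e where b: "i < N" "s \<le> e" "e \<le> n" "b = map (Pair i) [s..<e]"
      unfolding run_def by blast
    then have fi: "length (f i) = n" "reduced (f i)"
      using L(3) length_relator reduced_relator by auto
    have "f i = take s (f i) @ take (e - s) (drop s (f i)) @ drop (e - s) (drop s (f i))"
      by (simp only: append_take_drop_id)
    with fi(2) have "reduced (take (e - s) (drop s (f i)))"
      by (metis reduced_append)
    then show "reduced (map (tag_letter f) b)"
      using map_tag_letter_run[of f i n e s] b fi by simp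
  next
    fix P a a' Q
    assume "cancel (tag_letter f) L (P @ a @ a' @ Q)" "run n N a" "run n N a'"
      "map (tag_letter f) a' = inv_word (map (tag_letter f) a)"
    then show "length a < \<epsilon>"
      using remove_two_relators[OF L(1,3)] minimal L(2) by (meson not_le)
  qed
  obtain cs where cs: "L = concat cs" "length cs \<le> 2 * N" "\<forall>c\<in>set cs. run n N c"
    using tagged_runs[OF L(1)] by blast
  have "reduced_runs []"
    by (simp add: reduced_runs_def)
  then obtain bs where bs: "cancel (tag_letter f) L (concat bs)" "reduced_runs bs"
    "weight \<epsilon> bs \<ge> weight \<epsilon> ([] :: tag list list) + int (length (concat cs)) - 4 * int \<epsilon> * int (length cs)"
    using append_runs[of "[]" cs] cs cancel.cancel_refl by auto
  have "reduce W = map (tag_letter f) (concat bs)"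
    using cancel_reduce_letters[OF bs(1)] tagged_set[OF L(1)] L(2) bs(2)
    by (simp add: reduced_runs_def reduce_reduced)
  then have "weight \<epsilon> bs \<le> 0"
    using no_long_subword_runs[OF L(3)] bs(2) assms(2) unfolding reduced_runs_def by metis
  moreover have "length L = N * n"
    using tagged_set[OF L(1)] distinct_card[of L] by simp
  moreover have "4 * int \<epsilon> * int (length cs) \<le> 4 * int \<epsilon> * (2 * int N)"
    using cs(2) by (intro mult_left_mono) auto
  ultimately have "int N * int n - 8 * int \<epsilon> * int N \<le> 0"
    using bs(3) cs(1) by (simp add: weight_def mult.commute mult.left_commute)
  then have "int N * (int n - 8 * int \<epsilon>) \<le> 0"
    by (simp add: algebra_simps)
  then have "N = 0"
    using eps by (simp add: mult_le_0_iff)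
  then show ?thesis
    using tagged_set[OF L(1)] L(2) by simp
qed

text \<open>Outer induction on relators, inner induction on pairs. If a pair and the word
  \<open>B\<close> inside it survive, \<open>reduce B\<close> is a factor of
  \<open>reduce W\<close>, so induction applied to \<open>B\<close> contradicts its survival.
  Otherwise the pair is removed. Without pairs, a word with fewer relators and the same value is
  covered by the outer induction, so minimality may be assumed.\<close>

theorem no_long_subword_trivial:
  assumes "pattern R W N M" "no_long_subword (reduce W)"
  shows "reduce W = []"
  using assms
proof (induction N arbitrary: W M rule: less_induct)
  case (less N)
  note IH_N = less(1)
  from less(2,3) show ?case
  proof (induction M arbitrary: W rule: less_induct)
    case (less M)
    show ?case
    proof (cases "M = 0")
      case True
      show ?thesis
      proof (rule ccontr)
        assume "reduce W \<noteq> []"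
        then show False
          using pattern_without_pairs[of W N] less(2,3) IH_N True by metis
      qed
    next
      case False
      then obtain A x B C N1 M1 N2 M2 where W:
        "W = A @ x # B @ inv_letter x # C" "pattern R (A @ C) N1 M1" "pattern R B N2 M2"
        "N = N1 + N2" "M = Suc (M1 + M2)"
        using pattern_pairE[OF less(2)] by blast
      show ?thesis
      proof (cases "reduce B \<noteq> [] \<and> reduced (reduce A @ x # reduce B @ inv_letter x # reduce C)")
        case True
        have "reduce W = reduce (reduce A @ x # reduce B @ inv_letter x # reduce C)"
          unfolding W(1)
          by (intro reduce_append_cong)
            (auto simp: reduce_append_left reduce_append_right reduce_reduced reduced_reduce
              intro!: arg_cong[of _ _ "cons_reduce _"] reduce_append_cong)
        also have "\<dots> = (reduce A @ [x]) @ reduce B @ (inv_letter x # reduce C)"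
          using True by (simp add: reduce_reduced)
        finally have eq: "reduce W = (reduce A @ [x]) @ reduce B @ (inv_letter x # reduce C)" .
        have "no_long_subword (reduce B)"
          unfolding no_long_subword_def
        proof (intro ballI allI notI)
          fix r p s
          assume "r \<in> R" "reduce B = p @ take \<epsilon> r @ s"
          then have "reduce W = ((reduce A @ [x]) @ p) @ take \<epsilon> r @ (s @ inv_letter x # reduce C)"
            using eq by simp
          with less(3) \<open>r \<in> R\<close> show False
            unfolding no_long_subword_def by blast
        qed
        then have "reduce B = []"
          using less(1)[of M2 B] IH_N[of N2 B M2] W(3-5) by (cases "N2 < N") auto
        with True show ?thesis by simp
      next
        case False
        then obtain W' where "pattern R W' N (M1 + M2)" "reduce W' = reduce W"
          using pattern_remove_pair[OF W(2,3)] W(1,4) by metis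
        then show ?thesis
          using less(1)[of "M1 + M2" W'] less(3) W(5) by simp
      qed
    qed
  qed
qed

end


section \<open>Presented groups\<close>

definition symmetrized :: "'a word set \<Rightarrow> 'a word set" where
  "symmetrized X = {v @ u | u v. u @ v \<in> X \<or> inv_word (u @ v) \<in> X}"

lemma symmetrized_rotate:
  assumes "a @ b \<in> symmetrized X"
  shows "b @ a \<in> symmetrized X"
proof -
  obtain u v where uv: "a @ b = v @ u" "u @ v \<in> X \<or> inv_word (u @ v) \<in> X"
    using assms by (auto simp: symmetrized_def)
  from uv(1) consider d where "a = v @ d" "u = d @ b" | d where "v = a @ d" "b = d @ u"
    by (auto simp: append_eq_append_conv2)
  then show ?thesis
  proof cases
    case 1
    then show ?thesis
      using uv(2) unfolding symmetrized_def
      by (intro CollectI exI[of _ d] exI[of _ "b @ v"]) auto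
  next
    case 2
    then show ?thesis
      using uv(2) unfolding symmetrized_def
      by (intro CollectI exI[of _ "u @ a"] exI[of _ d]) auto
  qed
qed

lemma symmetrized_inv_word:
  assumes "r \<in> symmetrized X"
  shows "inv_word r \<in> symmetrized X"
proof -
  obtain u v where "r = v @ u" "u @ v \<in> X \<or> inv_word (u @ v) \<in> X"
    using assms by (auto simp: symmetrized_def)
  then show ?thesis
    unfolding symmetrized_def
    by (intro CollectI exI[of _ "inv_word v"] exI[of _ "inv_word u"]) auto
qed

lemma subset_symmetrized: "X \<subseteq> symmetrized X"
  by (force simp: symmetrized_def intro: exI[of _ "[]"])

lemma cyclically_reduced_append:
  "cyclically_reduced (u @ v) \<longleftrightarrow>
     reduced (u @ v) \<and> (v \<noteq> [] \<longrightarrow> hd (u @ v) \<noteq> inv_letter (last v)) \<and>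
     (v = [] \<longrightarrow> u \<noteq> [] \<longrightarrow> hd u \<noteq> inv_letter (last u))"
  by (cases "v = []") (auto simp: cyclically_reduced_def)

lemma cyclically_reduced_rotate: "cyclically_reduced (u @ v) \<Longrightarrow> cyclically_reduced (v @ u)"
  by (cases "u = []"; cases "v = []") (auto simp: cyclically_reduced_append reduced_append)

lemma cyclically_reduced_inv_word [simp]: "cyclically_reduced (inv_word w) \<longleftrightarrow> cyclically_reduced w"
proof (cases "w = []")
  case False
  then have "hd (inv_word w) = inv_letter (last w)" "last (inv_word w) = inv_letter (hd w)"
    by (simp_all add: inv_word_def hd_rev last_rev hd_map last_map)
  then show ?thesis
    using False by (auto simp: cyclically_reduced_def)
qed simp

lemma symmetrized_cyclically_reduced:
  assumes "\<And>r. r \<in> X \<Longrightarrow> cyclically_reduced r \<and> length r = n" "r \<in> symmetrized X"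
  shows "cyclically_reduced r \<and> length r = n"
proof -
  obtain u v where r: "r = v @ u" "u @ v \<in> X \<or> inv_word (u @ v) \<in> X"
    using assms(2) by (auto simp: symmetrized_def)
  then have "cyclically_reduced (u @ v) \<and> length (u @ v) = n"
    using assms(1) cyclically_reduced_inv_word length_inv_word by metis
  then show ?thesis
    using r(1) cyclically_reduced_rotate[of u v] by auto
qed

lemma symmetric_relators_symmetrized:
  assumes "\<And>r. r \<in> X \<Longrightarrow> cyclically_reduced r \<and> length r = n"
  shows "symmetric_relators (symmetrized X) n"
  using symmetrized_cyclically_reduced[OF assms] symmetrized_rotate symmetrized_inv_word
  by unfold_locales (auto simp: cyclically_reduced_def)

lemma carrier_free_group: "w \<in> carrier (free_group X) \<longleftrightarrow> reduced w \<and> fst ` set w \<subseteq> X"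
  by (simp add: free_group_def)

lemma mult_free_group [simp]: "u \<otimes>\<^bsub>free_group X\<^esub> v = reduce (u @ v)"
  by (simp add: free_group_def)

lemma one_free_group [simp]: "\<one>\<^bsub>free_group X\<^esub> = []"
  by (simp add: free_group_def)

lemma reduce_in_free_group: "fst ` set w \<subseteq> X \<Longrightarrow> reduce w \<in> carrier (free_group X)"
  using letters_reduce[of w] by (auto simp: carrier_free_group reduced_reduce)

lemma inv_free_group:
  assumes "w \<in> carrier (free_group X)"
  shows "inv\<^bsub>free_group X\<^esub> w = inv_word w"
proof -
  interpret group "free_group X"
    by (rule group_free_group)
  show ?thesis
    by (rule inv_equality) (use assms in \<open>auto simp: carrier_free_group simp flip: image_image\<close>)
qed

text \<open>The values of patterns in the free group form a normal subgroup containing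
  \<open>X\<close>: products come from concatenation, conjugates from nested pairs, inverses from
  closure of \<open>R\<close> under inversion.\<close>

lemma normal_closure_pattern:
  assumes X: "X \<subseteq> carrier (free_group Y)" and R: "symmetric_relators R n" "X \<subseteq> R"
    and w: "w \<in> normal_closure (free_group Y) X"
  shows "\<exists>W N M. pattern R W N M \<and> reduce W = w"
proof -
  interpret F: group "free_group Y"
    by (rule group_free_group)
  interpret symmetric_relators R n
    by (rule R)
  define H where "H = {w \<in> carrier (free_group Y). \<exists>W N M. pattern R W N M \<and> reduce W = w}"
  have H_mult: "u \<otimes>\<^bsub>free_group Y\<^esub> v \<in> H" if u: "u \<in> H" and v: "v \<in> H" for u v
  proof -
    obtain U N M where "pattern R U N M" "reduce U = u"
      using u unfolding H_def by blast
    moreover obtain V N' M' where "pattern R V N' M'" "reduce V = v"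
      using v unfolding H_def by blast
    ultimately have "pattern R (U @ V) (N + N') (M + M')" "reduce (U @ V) = reduce (u @ v)"
      by (auto intro: pattern_append simp: reduce_append_left reduce_append_right)
    then show ?thesis
      using u v F.m_closed[of u v] unfolding H_def by auto
  qed
  have H_inv: "inv_word u \<in> H" if u: "u \<in> H" for u
  proof -
    obtain U N M where "pattern R U N M" "reduce U = u"
      using u unfolding H_def by blast
    then have "pattern R (inv_word U) N M" "reduce (inv_word U) = inv_word u"
      using pattern_inv_word[OF inv_relator] by (auto simp: reduce_inv_word)
    then show ?thesis
      using u unfolding H_def by (auto simp: carrier_free_group)
  qed
  have "subgroup H (free_group Y)"
  proof (rule F.subgroupI)
    show "H \<subseteq> carrier (free_group Y)"
      by (auto simp: H_def)
    have "[] \<in> H"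
      unfolding H_def using pattern.Nil by (force simp: carrier_free_group)
    then show "H \<noteq> {}"
      by blast
    fix u
    assume u: "u \<in> H"
    then have "u \<in> carrier (free_group Y)"
      by (simp add: H_def)
    then show "inv\<^bsub>free_group Y\<^esub> u \<in> H"
      using H_inv[OF u] by (simp add: inv_free_group)
  qed (rule H_mult)
  moreover have "x \<otimes>\<^bsub>free_group Y\<^esub> h \<otimes>\<^bsub>free_group Y\<^esub> inv\<^bsub>free_group Y\<^esub> x \<in> H"
    if x: "x \<in> carrier (free_group Y)" and h: "h \<in> H" for x h
  proof -
    obtain W N M where W: "pattern R W N M" "reduce W = h"
      using h unfolding H_def by blast
    obtain M' where "pattern R (x @ W @ inv_word x) N M'"
      using pattern_conjugate[OF W(1)] by blast
    moreover have "reduce (x @ W @ inv_word x) = reduce (reduce (x @ h) @ inv_word x)"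
      using W(2) reduce_append_cong[of "x @ W" "x @ h" "inv_word x" "inv_word x"]
      by (simp add: reduce_append_left reduce_append_right flip: W(2))
    moreover have "h \<in> carrier (free_group Y)"
      using h by (simp add: H_def)
    ultimately show ?thesis
      using x F.m_closed[OF F.m_closed[OF x] F.inv_closed[OF x], of h]
      unfolding H_def by (auto simp: inv_free_group)
  qed
  ultimately have "H \<lhd> free_group Y"
    by (rule F.normal_invI)
  moreover have "X \<subseteq> H"
  proof
    fix r
    assume "r \<in> X"
    then have "r \<in> carrier (free_group Y)" "pattern R r 1 0"
      using X R(2) pattern_relator by blast+
    moreover from this have "reduce r = r"
      by (simp add: carrier_free_group reduce_reduced)
    ultimately show "r \<in> H"
      unfolding H_def by blast
  qed
  ultimately have "w \<in> H"
    using w unfolding normal_closure_def by blast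
  then show ?thesis
    by (simp add: H_def)
qed

section \<open>Evaluating words in a presented group\<close>

lemma word_value_Nil [simp]: "word_value G f [] = \<one>\<^bsub>G\<^esub>"
  by (simp add: word_value_def)

lemma word_value_Cons [simp]:
  "word_value G f (l # w) =
     (if snd l then f (fst l) else inv\<^bsub>G\<^esub> (f (fst l))) \<otimes>\<^bsub>G\<^esub> word_value G f w"
  by (simp add: word_value_def)

lemma mult_presented_group: "mult (presented_group X rs) = (<#>\<^bsub>free_group X\<^esub>)"
  by (simp add: presented_group_def FactGroup_def)

lemma presented_gen_closed:
  assumes "x \<in> X"
  shows "presented_gen X rs x \<in> carrier (presented_group X rs)"
proof -
  have "[(x, True)] \<in> carrier (free_group X)"
    using assms by (simp add: carrier_free_group reduced_Cons)
  then show ?thesis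
    unfolding presented_gen_def presented_group_def FactGroup_def RCOSETS_def by auto
qed

lemma word_value_presented_group:
  assumes rs: "set rs \<subseteq> carrier (free_group X)" and w: "fst ` set w \<subseteq> X"
  shows "word_value (presented_group X rs) (presented_gen X rs) w =
           normal_closure (free_group X) (set rs) #>\<^bsub>free_group X\<^esub> reduce w"
proof -
  interpret F: group "free_group X"
    by (rule group_free_group)
  let ?N = "normal_closure (free_group X) (set rs)"
  interpret N: normal ?N "free_group X"
    by (rule F.normal_normal_closure[OF rs])
  have letter: "(if snd l then presented_gen X rs (fst l)
      else inv\<^bsub>presented_group X rs\<^esub> (presented_gen X rs (fst l))) = ?N #>\<^bsub>free_group X\<^esub> [l]"
    if "fst l \<in> X" for l
  proof (cases "snd l")
    case True
    then show ?thesis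
      by (cases l) (simp add: presented_gen_def)
  next
    case False
    have c: "[(fst l, True)] \<in> carrier (free_group X)"
      using that by (simp add: carrier_free_group reduced_Cons)
    have "inv\<^bsub>presented_group X rs\<^esub> (presented_gen X rs (fst l)) =
        set_inv\<^bsub>free_group X\<^esub> (presented_gen X rs (fst l))"
      unfolding presented_group_def
      by (rule N.inv_FactGroup) (use c in \<open>auto simp: presented_gen_def FactGroup_def RCOSETS_def\<close>)
    also have "\<dots> = ?N #>\<^bsub>free_group X\<^esub> [l]"
      using False c N.rcos_inv[OF c]
      by (cases l) (simp add: presented_gen_def inv_free_group inv_word_def inv_letter_def)
    finally show ?thesis
      using False by simp
  qed
  show ?thesis
    using w
  proof (induction w)
    case Nil
    have "\<one>\<^bsub>presented_group X rs\<^esub> = ?N"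
      by (simp add: presented_group_def FactGroup_def)
    then show ?case
      using F.coset_mult_one[of ?N] N.subset by simp
  next
    case (Cons l w)
    have c: "[l] \<in> carrier (free_group X)" "reduce w \<in> carrier (free_group X)"
      using Cons(2) reduce_in_free_group[of w X] by (auto simp: carrier_free_group reduced_Cons)
    have "word_value (presented_group X rs) (presented_gen X rs) (l # w) =
        (?N #>\<^bsub>free_group X\<^esub> [l]) <#>\<^bsub>free_group X\<^esub> (?N #>\<^bsub>free_group X\<^esub> reduce w)"
      using Cons letter[of l] by (simp add: mult_presented_group)
    also have "\<dots> = ?N #>\<^bsub>free_group X\<^esub> ([l] \<otimes>\<^bsub>free_group X\<^esub> reduce w)"
      by (rule N.rcos_sum[OF c])
    also have "[l] \<otimes>\<^bsub>free_group X\<^esub> reduce w = reduce (l # w)"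
      using reduce_append_right[of "[l]" w] by simp
    finally show ?case .
  qed
qed

lemma word_value_in_generate:
  "fst ` set w \<subseteq> S \<Longrightarrow> word_value G f w \<in> generate G (f ` S)"
proof (induction w)
  case (Cons l w)
  have "f (fst l) \<in> f ` S"
    using Cons(2) by auto
  then show ?case
    using Cons by (auto intro!: generate.eng intro: generate.incl generate.inv)
qed (simp add: generate.one)

text \<open>Two words over \<open>S\<close> with the same value differ by an element of the normal
  closure, and this element is again a word over \<open>S\<close>.\<close>

lemma presented_subset_free:
  assumes rs: "set rs \<subseteq> carrier (free_group X)" and S: "S \<subseteq> X"
    and triv: "\<And>w. w \<in> normal_closure (free_group X) (set rs) \<Longrightarrow> fst ` set w \<subseteq> S \<Longrightarrow> w = []"
  shows "freely_generates (presented_group X rs) (presented_gen X rs) S"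
proof -
  interpret F: group "free_group X"
    by (rule group_free_group)
  interpret FS: group "free_group S"
    by (rule group_free_group)
  let ?N = "normal_closure (free_group X) (set rs)"
  interpret N: normal ?N "free_group X"
    by (rule F.normal_normal_closure[OF rs])
  let ?G = "presented_group X rs"
  interpret G: group ?G
    by (rule group_presented_group[OF rs])
  let ?f = "presented_gen X rs"
  let ?h = "word_value ?G ?f"
  have h: "?h w = ?N #>\<^bsub>free_group X\<^esub> w" "w \<in> carrier (free_group X)"
    if "w \<in> carrier (free_group S)" for w
    using word_value_presented_group[OF rs, of w] that S
    by (auto simp: carrier_free_group reduce_reduced)
  have h_mult: "?h (u \<otimes>\<^bsub>free_group S\<^esub> v) = ?h u \<otimes>\<^bsub>?G\<^esub> ?h v"
    if "u \<in> carrier (free_group S)" "v \<in> carrier (free_group S)" for u v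
  proof -
    have "?h u \<otimes>\<^bsub>?G\<^esub> ?h v = ?N #>\<^bsub>free_group X\<^esub> (u \<otimes>\<^bsub>free_group X\<^esub> v)"
      using N.rcos_sum[OF h(2) h(2)] that by (simp add: h mult_presented_group)
    then show ?thesis
      using h(1)[OF FS.m_closed[OF that]] by simp
  qed
  have image: "?h ` carrier (free_group S) = generate ?G (?f ` S)"
  proof (intro equalityI subsetI)
    fix g
    assume "g \<in> ?h ` carrier (free_group S)"
    then show "g \<in> generate ?G (?f ` S)"
      using word_value_in_generate by (auto simp: carrier_free_group)
  next
    fix g
    assume "g \<in> generate ?G (?f ` S)"
    then show "g \<in> ?h ` carrier (free_group S)"
    proof (induction rule: generate.induct)
      case one
      show ?case
        by (rule image_eqI[of _ _ "[]"]) (auto simp: carrier_free_group)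
    next
      case (incl g)
      then obtain x where x: "x \<in> S" "g = ?f x" by blast
      then have "?f x \<in> carrier ?G"
        using S by (intro presented_gen_closed) auto
      with x show ?case
        by (intro image_eqI[of _ _ "[(x, True)]"]) (auto simp: carrier_free_group reduced_Cons)
    next
      case (inv g)
      then obtain x where x: "x \<in> S" "g = ?f x" by blast
      then have "?f x \<in> carrier ?G"
        using S by (intro presented_gen_closed) auto
      with x show ?case
        by (intro image_eqI[of _ _ "[(x, False)]"]) (auto simp: carrier_free_group reduced_Cons)
    next
      case (eng g g')
      then obtain u v where "u \<in> carrier (free_group S)" "v \<in> carrier (free_group S)"
        "g = ?h u" "g' = ?h v" by blast
      then show ?case
        using h_mult FS.m_closed by (intro image_eqI[of _ _ "u \<otimes>\<^bsub>free_group S\<^esub> v"]) auto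
    qed
  qed
  have "inj_on ?h (carrier (free_group S))"
  proof (rule inj_onI)
    fix u v
    assume u: "u \<in> carrier (free_group S)" and v: "v \<in> carrier (free_group S)" and "?h u = ?h v"
    then have "u \<in> ?N #>\<^bsub>free_group X\<^esub> v"
      using F.rcos_self[OF h(2)[OF u] N.subgroup_axioms] h by simp
    then obtain g where g: "g \<in> ?N" "u = reduce (g @ v)"
      by (auto simp: r_coset_def)
    have gr: "reduced g"
      using g(1) N.subset by (auto simp: carrier_free_group)
    have "reduce (u @ inv_word v) = reduce (g @ v @ inv_word v)"
      using g(2) by (simp add: reduce_append_left)
    also have "\<dots> = g"
      using reduce_append_trivial[OF reduce_append_inv_word, of g v "[]"] gr by (simp add: reduce_reduced)
    finally have gu: "g = reduce (u @ inv_word v)" ..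
    have "fst ` set (u @ inv_word v) \<subseteq> S"
      using u v by (auto simp: carrier_free_group image_Un simp del: set_append simp add: set_append)
    then have "g \<in> carrier (free_group S)"
      unfolding gu by (rule reduce_in_free_group)
    then have "g = []"
      using triv[OF g(1)] by (simp add: carrier_free_group)
    then show "u = v"
      using g(2) v by (simp add: carrier_free_group reduce_reduced)
  qed
  with image h_mult show ?thesis
    unfolding freely_generates_def iso_def hom_def bij_betw_def by auto
qed

text \<open>A word over a proper subset misses some generator \<open>x\<close>, so it cannot contain
  a prefix of a relator in which every generator occurs; small cancellation then makes it
  trivial.\<close>

lemma proper_subsets_freeI:
  assumes rs: "set rs \<subseteq> {w \<in> cyclically_reduced_words k. length w = n}"
    and eps: "0 < \<epsilon>" "8 * \<epsilon> < n"
    and letters: "\<And>r. r \<in> symmetrized (set rs) \<Longrightarrow> {1..k} \<subseteq> fst ` set (take \<epsilon> r)"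
    and piece: "\<And>r r'. r \<in> symmetrized (set rs) \<Longrightarrow> r' \<in> symmetrized (set rs) \<Longrightarrow>
      take \<epsilon> r = take \<epsilon> r' \<Longrightarrow> r = r'"
  shows "proper_subsets_free k rs"
  unfolding proper_subsets_free_def
proof (intro allI impI)
  fix S
  assume S: "S \<subset> {1..k}"
  then obtain x where x: "x \<in> {1..k}" "x \<notin> S" by blast
  have carr: "set rs \<subseteq> carrier (free_group {1..k})"
    using rs by (auto simp: cyclically_reduced_words_def)
  have sym: "symmetric_relators (symmetrized (set rs)) n"
    by (rule symmetric_relators_symmetrized) (use rs in \<open>auto simp: cyclically_reduced_words_def\<close>)
  interpret small_cancellation "symmetrized (set rs)" n \<epsilon>
    using sym piece eps by (intro small_cancellation.intro) (auto simp: small_cancellation_axioms_def)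
  show "freely_generates (presented_group {1..k} rs) (presented_gen {1..k} rs) S"
  proof (rule presented_subset_free[OF carr])
    show "S \<subseteq> {1..k}"
      using S by blast
    fix w
    assume "w \<in> normal_closure (free_group {1..k}) (set rs)" and wS: "fst ` set w \<subseteq> S"
    then obtain W N M where W: "pattern (symmetrized (set rs)) W N M" "reduce W = w"
      using normal_closure_pattern[OF carr sym subset_symmetrized] by blast
    have "no_long_subword w"
      unfolding no_long_subword_def
    proof (intro ballI allI notI)
      fix r p s
      assume "r \<in> symmetrized (set rs)" "w = p @ take \<epsilon> r @ s"
      moreover have "x \<in> fst ` set (take \<epsilon> r)"
        using letters[of r] calculation x by blast
      ultimately have "x \<in> fst ` set w"
        by (metis (no_types) Un_iff image_Un set_append)
      then show False
        using x wS by blast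
    qed
    then show "w = []"
      using no_long_subword_trivial[OF W(1)] W(2) by simp
  qed
qed


section \<open>Counting words\<close>

lemma inj_rotate: "inj (rotate s)"
  unfolding rotate_def by (rule inj_fn[OF inj_rotate1])

text \<open>Union bound over the coordinate. The forbidden set may depend on the remaining entries,
  which is how coincidences between two relators are counted.\<close>

lemma card_lists_coordinate:
  fixes C :: "'b set" and F :: "'b list \<Rightarrow> 'b set"
  assumes "finite C"
    and e: "\<And>rest. set rest \<subseteq> C \<Longrightarrow> length rest = m - 1 \<Longrightarrow> card {x \<in> C. x \<in> F rest} \<le> e"
  shows "card {xs. length xs = m \<and> set xs \<subseteq> C \<and>
      (\<exists>i<m. xs ! i \<in> F (take i xs @ drop (Suc i) xs))} \<le> m * (card C ^ (m - 1) * e)"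
proof -
  let ?rest = "\<lambda>i xs. take i xs @ drop (Suc i) xs"
  let ?L = "{xs. set xs \<subseteq> C \<and> length xs = m - 1}"
  define B where "B i = {xs. length xs = m \<and> set xs \<subseteq> C \<and> xs ! i \<in> F (?rest i xs)}" for i
  have finL: "finite ?L"
    using finite_lists_length_eq[OF assms(1)] by simp
  have "card (B i) \<le> card C ^ (m - 1) * e" if "i < m" for i
  proof -
    let ?S = "Sigma ?L (\<lambda>rest. {x \<in> C. x \<in> F rest})"
    have "card (B i) \<le> card ?S"
    proof (rule card_inj_on_le)
      show "inj_on (\<lambda>xs. (?rest i xs, xs ! i)) (B i)"
      proof (rule inj_onI)
        fix xs ys
        assume xs: "xs \<in> B i" and ys: "ys \<in> B i"
          and eq: "(?rest i xs, xs ! i) = (?rest i ys, ys ! i)"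
        have "length xs = m" "length ys = m"
          using xs ys by (auto simp: B_def)
        moreover from this have "take i xs = take i ys" "drop (Suc i) xs = drop (Suc i) ys"
          using eq by (simp_all add: append_eq_append_conv)
        ultimately show "xs = ys"
          using eq \<open>i < m\<close> id_take_nth_drop[of i xs] id_take_nth_drop[of i ys] by simp
      qed
      show "(\<lambda>xs. (?rest i xs, xs ! i)) ` B i \<subseteq> ?S"
      proof
        fix z
        assume "z \<in> (\<lambda>xs. (?rest i xs, xs ! i)) ` B i"
        then obtain xs where xs: "length xs = m" "set xs \<subseteq> C" "xs ! i \<in> F (?rest i xs)"
          "z = (?rest i xs, xs ! i)"
          by (auto simp: B_def)
        have "set (?rest i xs) \<subseteq> C"
          using xs(2) set_take_subset[of i xs] set_drop_subset[of "Suc i" xs] by auto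
        moreover have "xs ! i \<in> C"
          using xs(1,2) \<open>i < m\<close> by auto
        ultimately show "z \<in> ?S"
          using xs \<open>i < m\<close> by auto
      qed
      show "finite ?S"
        using finL assms(1) by auto
    qed
    also have "\<dots> = (\<Sum>rest\<in>?L. card {x \<in> C. x \<in> F rest})"
      using finL assms(1) by simp
    also have "\<dots> \<le> (\<Sum>rest\<in>?L. e)"
      using e by (intro sum_mono) auto
    also have "\<dots> = card C ^ (m - 1) * e"
      by (simp add: card_lists_length_eq[OF assms(1)])
    finally show ?thesis .
  qed
  moreover have "{xs. length xs = m \<and> set xs \<subseteq> C \<and> (\<exists>i<m. xs ! i \<in> F (?rest i xs))} = (\<Union>i<m. B i)"
    by (auto simp: B_def)
  ultimately show ?thesis
    using card_UN_le[of "{..<m}" B] sum_bounded_above[of "{..<m}" "\<lambda>i. card (B i)" "card C ^ (m - 1) * e"]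
    by simp
qed

text \<open>Chain rule for counting: \<open>c q\<close> bounds the number of continuations at
  position \<open>q\<close> once the preceding letters are fixed.\<close>

lemma card_words_le_prod:
  fixes X :: "'b list set"
  assumes X: "finite X" "\<And>w. w \<in> X \<Longrightarrow> length w = n"
    and c: "\<And>q p. q < n \<Longrightarrow> card {w ! q | w. w \<in> X \<and> take q w = p} \<le> c q"
  shows "card X \<le> (\<Prod>q<n. c q)"
proof -
  have "card (take q ` X) \<le> (\<Prod>i<q. c i)" if "q \<le> n" for q
    using that
  proof (induction q)
    case 0
    have "take 0 ` X \<subseteq> {[]}"
      by auto
    then show ?case
      using card_mono[of "{[]}" "take 0 ` X"] by simp
  next
    case (Suc q)
    let ?N = "\<lambda>p. {w ! q | w. w \<in> X \<and> take q w = p}"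
    let ?S = "Sigma (take q ` X) ?N"
    have fin: "finite (?N p)" for p
      using X(1) by simp
    have "take (Suc q) ` X \<subseteq> (\<lambda>(p, l). p @ [l]) ` ?S"
    proof
      fix u
      assume "u \<in> take (Suc q) ` X"
      then obtain w where w: "w \<in> X" "u = take (Suc q) w" by blast
      then have "u = (\<lambda>(p, l). p @ [l]) (take q w, w ! q)"
        using X(2)[OF w(1)] Suc(2) by (simp add: take_Suc_conv_app_nth)
      moreover have "(take q w, w ! q) \<in> ?S"
        using w(1) by auto
      ultimately show "u \<in> (\<lambda>(p, l). p @ [l]) ` ?S"
        by blast
    qed
    then have "card (take (Suc q) ` X) \<le> card ((\<lambda>(p, l). p @ [l]) ` ?S)"
      using X(1) fin by (intro card_mono) auto
    also have "\<dots> \<le> card ?S"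
      using X(1) fin by (intro card_image_le) auto
    also have "\<dots> = (\<Sum>p\<in>take q ` X. card (?N p))"
      using X(1) fin by simp
    also have "\<dots> \<le> card (take q ` X) * c q"
      using c[of q] Suc(2) sum_bounded_above[of "take q ` X" "\<lambda>p. card (?N p)" "c q"] by simp
    also have "\<dots> \<le> (\<Prod>i<q. c i) * c q"
      using Suc by simp
    finally show ?case
      by simp
  qed
  from this[of n] show ?thesis
    using X(2) by (simp cong: image_cong)
qed

section \<open>Numbers of reduced and cyclically reduced words\<close>

definition reduced_words :: "nat \<Rightarrow> nat \<Rightarrow> nat word set" where
  "reduced_words k n = {w \<in> carrier (free_group {1..k}). length w = n}"

definition relator_words :: "nat \<Rightarrow> nat \<Rightarrow> nat word set" where
  "relator_words k n = {w \<in> cyclically_reduced_words k. length w = n}"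

abbreviation letters :: "nat \<Rightarrow> nat letter set" where
  "letters k \<equiv> {1..k} \<times> UNIV"

lemma card_letters: "card (letters k) = 2 * k"
  by (simp add: card_cartesian_product card_UNIV_bool)

lemma letters_iff: "set w \<subseteq> letters k \<longleftrightarrow> fst ` set w \<subseteq> {1..k}"
  by (fastforce simp: image_subset_iff)

lemma reduced_words_iff: "w \<in> reduced_words k n \<longleftrightarrow> reduced w \<and> set w \<subseteq> letters k \<and> length w = n"
  unfolding reduced_words_def letters_iff by (auto simp: carrier_free_group)

lemma relator_words_iff:
  "w \<in> relator_words k n \<longleftrightarrow> cyclically_reduced w \<and> set w \<subseteq> letters k \<and> length w = n"
  unfolding relator_words_def cyclically_reduced_words_def letters_iff
  by (auto simp: carrier_free_group cyclically_reduced_def)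

lemma finite_reduced_words [simp]: "finite (reduced_words k n)"
proof (rule finite_subset)
  show "reduced_words k n \<subseteq> {w. set w \<subseteq> letters k \<and> length w = n}"
    using reduced_words_iff by blast
qed (simp add: finite_lists_length_eq)

lemma relator_subset_reduced: "relator_words k n \<subseteq> reduced_words k n"
  by (auto simp: relator_words_iff reduced_words_iff cyclically_reduced_def)

lemma finite_relator_words [simp]: "finite (relator_words k n)"
  by (rule finite_subset[OF relator_subset_reduced finite_reduced_words])

lemma card_relator_words_le: "card (relator_words k n) \<le> (2 * k) ^ n"
proof -
  have "card (relator_words k n) \<le> card {w. set w \<subseteq> letters k \<and> length w = n}"
    by (rule card_mono) (use finite_lists_length_eq[of "letters k" n] relator_words_iff in \<open>simp, blast\<close>)
  then show ?thesis
    by (simp add: card_lists_length_eq card_letters power_mult_distrib mult.commute)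
qed

lemma card_reduced_words_ge: "(2 * k - 1) ^ n \<le> card (reduced_words k n)"
proof (induction n)
  case 0
  have "[] \<in> reduced_words k 0"
    by (simp add: reduced_words_iff)
  then have "card (reduced_words k 0) > 0"
    by (auto simp: card_gt_0_iff)
  then show ?case by simp
next
  case (Suc n)
  let ?A = "\<lambda>w. letters k - {inv_letter (hd w)}"
  let ?S = "Sigma (reduced_words k n) ?A"
  have A: "2 * k - 1 \<le> card (?A w)" for w :: "nat word"
    using diff_card_le_card_Diff[of "{inv_letter (hd w)}" "letters k"] card_letters by simp
  have "(2 * k - 1) ^ Suc n \<le> (\<Sum>w\<in>reduced_words k n. 2 * k - 1)"
    using Suc by (simp add: mult.commute)
  also have "\<dots> \<le> (\<Sum>w\<in>reduced_words k n. card (?A w))"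
    using A by (intro sum_mono) auto
  also have "\<dots> = card ?S"
    by simp
  also have "\<dots> \<le> card (reduced_words k (Suc n))"
  proof (rule card_inj_on_le[of "\<lambda>(w, l). l # w"])
    show "(\<lambda>(w, l). l # w) ` ?S \<subseteq> reduced_words k (Suc n)"
      by (auto simp: reduced_words_iff reduced_Cons)
  qed (auto simp: inj_on_def)
  finally show ?case .
qed

text \<open>Every reduced word of length \<open>n - 1\<close> becomes cyclically reduced by
  appending one letter: at most two letters are forbidden, and there are at least four.\<close>

lemma card_relator_words_ge:
  assumes "k \<ge> 2" "n \<ge> 1"
  shows "(2 * k - 1) ^ (n - 1) \<le> card (relator_words k n)"
proof (cases n)
  case 0
  with assms show ?thesis by simp
next
  case (Suc j)
  have "\<exists>l\<in>letters k. w = [] \<or> l \<noteq> inv_letter (last w) \<and> l \<noteq> inv_letter (hd w)" for w :: "nat word"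
  proof -
    have "card {inv_letter (last w), inv_letter (hd w)} \<le> 2"
      by (simp add: card_insert_if)
    then have "card (letters k - {inv_letter (last w), inv_letter (hd w)}) > 0"
      using diff_card_le_card_Diff[of "{inv_letter (last w), inv_letter (hd w)}" "letters k"]
        card_letters[of k] assms(1) by simp
    then obtain l where "l \<in> letters k - {inv_letter (last w), inv_letter (hd w)}"
      by (metis card_gt_0_iff ex_in_conv)
    then show ?thesis by blast
  qed
  then obtain g where g: "\<And>w. g w \<in> letters k"
    "\<And>w. w = [] \<or> g w \<noteq> inv_letter (last w) \<and> g w \<noteq> inv_letter (hd w)"
    by metis
  have "card (reduced_words k j) \<le> card (relator_words k n)"
  proof (rule card_inj_on_le[of "\<lambda>w. w @ [g w]"])
    show "(\<lambda>w. w @ [g w]) ` reduced_words k j \<subseteq> relator_words k n"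
    proof
      fix u
      assume "u \<in> (\<lambda>w. w @ [g w]) ` reduced_words k j"
      then obtain w where w: "reduced w" "set w \<subseteq> letters k" "length w = j" "u = w @ [g w]"
        by (auto simp: reduced_words_iff)
      have "w = [] \<or> hd w \<noteq> inv_letter (g w)"
        using g(2)[of w] by (metis inv_letter_inv_letter)
      then have "cyclically_reduced u"
        using w(1,4) g(2)[of w]
        by (cases "w = []") (auto simp: cyclically_reduced_def reduced_append reduced_Cons)
      then show "u \<in> relator_words k n"
        using w g(1)[of w] Suc by (simp add: relator_words_iff)
    qed
  qed (auto simp: inj_on_def)
  then show ?thesis
    using card_reduced_words_ge[of k j] Suc by simp
qed

text \<open>The factors stand for the first letter, for the \<open>n - \<epsilon>\<close>
  unconstrained later letters, and for the \<open>\<epsilon> - 1\<close> letters of a window. The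
  value 2k-3 comes from omitting one generator: its two letters are excluded in addition to the
  inverse of the preceding letter.\<close>

definition window_bound :: "nat \<Rightarrow> nat \<Rightarrow> nat \<Rightarrow> nat" where
  "window_bound k n \<epsilon> = 2 * k * (2 * k - 1) ^ (n - \<epsilon>) * (2 * k - 3) ^ (\<epsilon> - 1)"

text \<open>Position \<open>t\<close>, where the window starts, is left unconstrained. So every
  constrained letter has a predecessor in the window, and position 0 is never constrained.\<close>

lemma card_words_window_le:
  assumes k: "k \<ge> 2" and t: "t + \<epsilon> \<le> n" "0 < \<epsilon>" and X: "X \<subseteq> reduced_words k n"
    and window: "\<And>q p. t < q \<Longrightarrow> q < t + \<epsilon> \<Longrightarrow>
      card {w ! q | w. w \<in> X \<and> take q w = p} \<le> 2 * k - 3"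
  shows "card X \<le> window_bound k n \<epsilon>"
proof -
  let ?W = "{t<..<t + \<epsilon>}"
  define c where "c q = (if q = 0 then 2 * k else if q \<in> ?W then 2 * k - 3 else 2 * k - 1)" for q
  have "card X \<le> (\<Prod>q<n. c q)"
  proof (rule card_words_le_prod)
    show "finite X"
      using X finite_subset finite_reduced_words by blast
    show "length w = n" if "w \<in> X" for w
      using that X by (auto simp: reduced_words_iff)
    fix q p
    assume "q < n"
    let ?N = "{w ! q | w. w \<in> X \<and> take q w = p}"
    have N: "?N \<subseteq> letters k"
    proof
      fix l
      assume "l \<in> ?N"
      then obtain w where "w \<in> X" "l = w ! q" by blast
      moreover from this have "length w = n" "set w \<subseteq> letters k"
        using X reduced_words_iff by blast+
      ultimately show "l \<in> letters k"
        using \<open>q < n\<close> nth_mem[of q w] by blast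
    qed
    consider "q = 0" | "q \<in> ?W" "q \<noteq> 0" | "q \<notin> ?W" "q \<noteq> 0"
      by blast
    then show "card ?N \<le> c q"
    proof cases
      case 1
      then show ?thesis
        using card_mono[OF _ N] card_letters by (simp add: c_def)
    next
      case 2
      then show ?thesis
        using window[of q p] by (simp add: c_def)
    next
      case 3
      show ?thesis
      proof (cases "?N = {}")
        case False
        then obtain w0 where w0: "w0 \<in> X" "take q w0 = p" by blast
        then have "set w0 \<subseteq> letters k" "length w0 = n"
          using X reduced_words_iff by blast+
        then have p: "p \<noteq> []" "set p \<subseteq> letters k"
          using w0 3 \<open>q < n\<close> set_take_subset[of q w0] by auto
        then have "last p \<in> letters k"
          using last_in_set by blast
        then have inv: "inv_letter (last p) \<in> letters k"
          by (cases "last p") (auto simp: inv_letter_def)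
        have "?N \<subseteq> letters k - {inv_letter (last p)}"
        proof
          fix l
          assume l: "l \<in> ?N"
          then obtain w where w: "w \<in> X" "take q w = p" "l = w ! q" by blast
          then have "reduced (p @ drop q w)" "drop q w \<noteq> []" "hd (drop q w) = l"
            using X \<open>q < n\<close> append_take_drop_id[of q w] by (auto simp: reduced_words_iff hd_drop_conv_nth)
          then show "l \<in> letters k - {inv_letter (last p)}"
            using N l p(1) by (auto simp: reduced_append)
        qed
        then have "card ?N \<le> card (letters k - {inv_letter (last p)})"
          by (intro card_mono) auto
        also have "\<dots> = 2 * k - 1"
          using inv card_letters by simp
        finally show ?thesis
          using 3 by (auto simp: c_def)
      next
        case True
        then show ?thesis
          by (simp only: card.empty)
      qed
    qed
  qed
  also have "{..<n} = insert 0 (?W \<union> ({0<..<n} - ?W))"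
    using t by auto
  also have "(\<Prod>q\<in>\<dots>. c q) = c 0 * ((\<Prod>q\<in>?W. c q) * (\<Prod>q\<in>{0<..<n} - ?W. c q))"
    by (subst prod.insert) (auto simp: prod.union_disjoint[symmetric] intro!: prod.union_disjoint)
  also have "(\<Prod>q\<in>?W. c q) = (2 * k - 3) ^ (\<epsilon> - 1)"
    by (simp add: c_def)
  also have "(\<Prod>q\<in>{0<..<n} - ?W. c q) = (2 * k - 1) ^ (n - \<epsilon>)"
  proof -
    have "(\<Prod>q\<in>{0<..<n} - ?W. c q) = (\<Prod>q\<in>{0<..<n} - ?W. 2 * k - 1)"
      by (rule prod.cong) (auto simp: c_def)
    moreover have "?W \<subseteq> {0<..<n}"
      using t by auto
    then have "card ({0<..<n} - ?W) = n - \<epsilon>"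
      using t by (simp add: card_Diff_subset)
    ultimately show ?thesis by simp
  qed
  finally show ?thesis
    by (simp add: c_def window_bound_def mult.assoc mult.commute mult.left_commute)
qed

text \<open>One choice per letter instead of 2k-3 is bounded generously, so that all bad events
  share the bound for a missing generator.\<close>

lemma card_words_determined_le:
  assumes k: "k \<ge> 2" and t: "t + \<epsilon> \<le> n" "0 < \<epsilon>" and X: "X \<subseteq> reduced_words k n"
    and det: "\<And>w q. w \<in> X \<Longrightarrow> t < q \<Longrightarrow> q < t + \<epsilon> \<Longrightarrow> w ! q = F q (take q w)"
  shows "card X \<le> window_bound k n \<epsilon>"
proof (rule card_words_window_le[OF k t X])
  fix q p
  assume q: "t < q" "q < t + \<epsilon>"
  have "{w ! q | w. w \<in> X \<and> take q w = p} \<subseteq> {F q p}"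
    using det q by blast
  then have "card {w ! q | w. w \<in> X \<and> take q w = p} \<le> card {F q p}"
    by (intro card_mono) auto
  then show "card {w ! q | w. w \<in> X \<and> take q w = p} \<le> 2 * k - 3"
    using k by simp
qed

lemma card_words_missing_letter_le:
  assumes k: "k \<ge> 2" and \<epsilon>: "\<epsilon> \<le> n" "0 < \<epsilon>" and x: "x \<in> {1..k}"
  shows "card {w \<in> reduced_words k n. x \<notin> fst ` set (take \<epsilon> w)} \<le> window_bound k n \<epsilon>"
proof (rule card_words_window_le[OF k])
  let ?X = "{w \<in> reduced_words k n. x \<notin> fst ` set (take \<epsilon> w)}"
  show "0 + \<epsilon> \<le> n" "0 < \<epsilon>" "?X \<subseteq> reduced_words k n"
    using \<epsilon> by auto
  fix q p
  assume q: "0 < q" "q < 0 + \<epsilon>"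
  let ?N = "{w ! q | w. w \<in> ?X \<and> take q w = p}"
  show "card ?N \<le> 2 * k - 3"
  proof (cases "?N = {}")
    case False
    then obtain w0 where w0: "w0 \<in> ?X" "take q w0 = p" by blast
    have p: "p \<noteq> []" "set p \<subseteq> letters k"
      using w0 q \<epsilon> set_take_subset[of q w0] by (auto simp: reduced_words_iff)
    have "set p \<subseteq> set (take \<epsilon> w0)"
      using w0(2) q set_take_subset_set_take[of q \<epsilon> w0] by simp
    then have "last p \<in> letters k" "last p \<in> set (take \<epsilon> w0)"
      using p last_in_set[OF p(1)] by blast+
    moreover from this have "fst (last p) \<noteq> x"
      using w0(1) by (metis (mono_tags, lifting) CollectD imageI)
    ultimately have inv: "inv_letter (last p) \<in> letters k" "fst (inv_letter (last p)) \<noteq> x"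
      by (cases "last p"; auto simp: inv_letter_def)+
    \<comment> \<open>Three different letters: the predecessor \<open>last p\<close> lies in the
      window and therefore does not belong to the generator \<open>x\<close>.\<close>
    let ?D = "{inv_letter (last p), (x, True), (x, False)}"
    have "?N \<subseteq> letters k - ?D"
    proof
      fix l
      assume l: "l \<in> ?N"
      then obtain w where w: "w \<in> ?X" "take q w = p" "l = w ! q" by blast
      then have "reduced (p @ drop q w)" "drop q w \<noteq> []" "hd (drop q w) = l"
        using q \<epsilon> append_take_drop_id[of q w] by (auto simp: reduced_words_iff hd_drop_conv_nth)
      then have "l \<noteq> inv_letter (last p)"
        using p(1) by (auto simp: reduced_append)
      moreover have "l \<in> set (take \<epsilon> w)"
        using w q \<epsilon> by (auto simp: reduced_words_iff in_set_conv_nth intro!: exI[of _ q])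
      then have "fst l \<noteq> x" "l \<in> letters k"
        using w(1) set_take_subset[of \<epsilon> w] by (auto simp: reduced_words_iff)
      ultimately show "l \<in> letters k - ?D"
        by auto
    qed
    then have "card ?N \<le> card (letters k - ?D)"
      by (intro card_mono) auto
    also have "\<dots> = card (letters k) - card ?D"
      using inv x by (intro card_Diff_subset) auto
    also have "card ?D = 3"
      using inv(2) by (cases "inv_letter (last p)") (simp add: card_insert_if)
    finally show ?thesis
      using card_letters by simp
  next
    case True
    then show ?thesis
      by (simp only: card.empty)
  qed
qed


section \<open>Relators with long pieces\<close>

lemma symmetrized_singleton:
  assumes "length r = n" "0 < n"
  shows "symmetrized {r} =
    (\<lambda>s. rotate s r) ` {..<n} \<union> (\<lambda>s. inv_word (rotate s r)) ` {..<n}" (is "_ = ?A \<union> ?B")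
proof (intro equalityI subsetI)
  fix q
  assume "q \<in> symmetrized {r}"
  then obtain u v where uv: "q = v @ u" "u @ v = r \<or> inv_word (u @ v) = r"
    by (auto simp: symmetrized_def)
  from uv(2) show "q \<in> ?A \<union> ?B"
  proof
    assume "u @ v = r"
    then have "q = rotate (length u mod n) r"
      using uv(1) rotate_append[of u v] rotate_conv_mod[of "length u" r] assms(1) by simp
    then show ?thesis
      using assms(2) by auto
  next
    assume "inv_word (u @ v) = r"
    then have "rotate (length v mod n) r = inv_word u @ inv_word v"
      using rotate_append[of "inv_word v" "inv_word u"] rotate_conv_mod[of "length v" r] assms(1) by simp
    then have "q = inv_word (rotate (length v mod n) r)"
      using uv(1) by simp
    then show ?thesis
      using assms(2) by auto
  qed
next
  fix q
  assume "q \<in> ?A \<union> ?B"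
  then obtain s where s: "s < n" "q = rotate s r \<or> q = inv_word (rotate s r)" by auto
  have "r \<in> symmetrized {r}"
    using subset_symmetrized by blast
  then have "rotate s r \<in> symmetrized {r}"
    using s(1) assms(1) symmetrized_rotate[of "take s r" "drop s r" "{r}"] by (simp add: rotate_drop_take)
  then show "q \<in> symmetrized {r}"
    using s(2) symmetrized_inv_word by auto
qed

lemma card_symmetrized_singleton_le:
  assumes "length r = n" "0 < n"
  shows "card (symmetrized {r}) \<le> 2 * n"
proof -
  have "card (symmetrized {r}) \<le> card ((\<lambda>s. rotate s r) ` {..<n}) + card ((\<lambda>s. inv_word (rotate s r)) ` {..<n})"
    unfolding symmetrized_singleton[OF assms] by (rule card_Un_le)
  also have "\<dots> \<le> n + n"
    using card_image_le[of "{..<n}"] by (intro add_mono) auto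
  finally show ?thesis by simp
qed

text \<open>A prefix of an inverse is the inverse of a suffix, and a suffix is a prefix of a
  rotation. This reduces inverted relators to rotations.\<close>

lemma take_rotate_inv_word:
  assumes "length p = n" "0 < \<epsilon>" "\<epsilon> \<le> n"
  shows "take \<epsilon> (rotate (n - \<epsilon>) p) = inv_word (take \<epsilon> (inv_word p))"
proof -
  have "take \<epsilon> (rotate (n - \<epsilon>) p) = drop (n - \<epsilon>) p"
    using assms by (simp add: rotate_drop_take)
  then show ?thesis
    using assms by (simp add: inv_word_def take_rev take_map drop_map rev_map comp_def)
qed

lemma relator_words_rotate:
  assumes "w \<in> relator_words k n"
  shows "rotate s w \<in> relator_words k n"
proof -
  let ?m = "s mod length w"
  have "cyclically_reduced (drop ?m w @ take ?m w)"
    by (rule cyclically_reduced_rotate) (use assms in \<open>simp add: relator_words_iff\<close>)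
  then show ?thesis
    using assms by (auto simp: relator_words_iff rotate_drop_take[symmetric])
qed

text \<open>Rotation is injective and preserves relators, so an event at any starting point is
  bounded by the same event at position 0.\<close>

lemma card_rotate_preimage_le:
  assumes "\<And>w. w \<in> relator_words k n \<Longrightarrow> w \<in> Y \<Longrightarrow> w \<in> Z" "card {w \<in> relator_words k n. w \<in> Z} \<le> b"
  shows "card {w \<in> relator_words k n. rotate s w \<in> Y} \<le> b"
proof -
  have "card {w \<in> relator_words k n. rotate s w \<in> Y} \<le> card {w \<in> relator_words k n. w \<in> Z}"
    by (rule card_inj_on_le[OF inj_on_subset[OF inj_rotate[of s]]])
      (use assms(1) relator_words_rotate in auto)
  with assms(2) show ?thesis by simp
qed

lemma card_UN_le_mult:
  assumes "finite I" "card I \<le> a" "\<And>i. i \<in> I \<Longrightarrow> card (A i) \<le> b"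
  shows "card (\<Union>i\<in>I. A i) \<le> a * b"
proof -
  have "card (\<Union>i\<in>I. A i) \<le> card I * b"
    using card_UN_le[OF assms(1), of A] sum_bounded_above[of I "\<lambda>i. card (A i)" b] assms(3) by simp
  then show ?thesis
    using assms(2) by (meson le_trans mult_le_mono1)
qed

locale window =
  fixes k n \<epsilon> :: nat
  assumes k: "k \<ge> 2" and \<epsilon>: "0 < \<epsilon>" "2 * \<epsilon> \<le> n"
begin

abbreviation "C \<equiv> relator_words k n"
abbreviation "Q \<equiv> window_bound k n \<epsilon>"

definition misses_generator :: "nat word set" where
  "misses_generator = {r. \<exists>q\<in>symmetrized {r}. \<not> {1..k} \<subseteq> fst ` set (take \<epsilon> q)}"

definition self_piece :: "nat word set" where
  "self_piece = {r. \<exists>q\<in>symmetrized {r}. \<exists>q'\<in>symmetrized {r}. q \<noteq> q' \<and> take \<epsilon> q = take \<epsilon> q'}"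

definition common_piece :: "nat word \<Rightarrow> nat word set" where
  "common_piece r = {r'. \<exists>q\<in>symmetrized {r}. \<exists>q'\<in>symmetrized {r'}. take \<epsilon> q = take \<epsilon> q'}"

lemma length_C: "r \<in> C \<Longrightarrow> length r = n"
  by (simp add: relator_words_iff)

lemma n_pos: "0 < n"
  using \<epsilon> by simp

lemma symmetrized_cases:
  assumes "r \<in> C" "q \<in> symmetrized {r}"
  obtains s where "s < n" "q = rotate s r" | s where "s < n" "q = inv_word (rotate s r)"
  using assms(2) unfolding symmetrized_singleton[OF length_C[OF assms(1)] n_pos] by auto

lemma rotate_mod: "r \<in> C \<Longrightarrow> rotate (s mod n) r = rotate s r"
  using rotate_conv_mod[of s r] length_C by simp

lemma misses_generator_le: "card {r \<in> C. r \<in> misses_generator} \<le> n * (k * Q)"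
proof -
  let ?Y = "\<lambda>x. {w. x \<notin> fst ` set (take \<epsilon> w)}"
  let ?U = "\<Union>s\<in>{..<n}. \<Union>x\<in>{1..k}. {r \<in> C. rotate s r \<in> ?Y x}"
  have "{r \<in> C. r \<in> misses_generator} \<subseteq> ?U"
  proof
    fix r
    assume r: "r \<in> {r \<in> C. r \<in> misses_generator}"
    then obtain q x where q: "r \<in> C" "q \<in> symmetrized {r}" "x \<in> {1..k}" "x \<notin> fst ` set (take \<epsilon> q)"
      unfolding misses_generator_def by blast
    from q(1,2) have "\<exists>s<n. fst ` set (take \<epsilon> q) = fst ` set (take \<epsilon> (rotate s r))"
    proof (cases rule: symmetrized_cases)
      case (2 s)
      have "take \<epsilon> (rotate ((n - \<epsilon> + s) mod n) r) = inv_word (take \<epsilon> q)"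
        using take_rotate_inv_word[of "rotate s r" n \<epsilon>] q(1) \<epsilon> 2 length_C
        by (simp add: rotate_mod rotate_rotate)
      then show ?thesis
        using n_pos by (intro exI[of _ "(n - \<epsilon> + s) mod n"]) simp
    qed auto
    then obtain s where "s < n" "x \<notin> fst ` set (take \<epsilon> (rotate s r))"
      using q(4) by auto
    with q show "r \<in> ?U"
      by (intro UN_I[of s] UN_I[of x]) auto
  qed
  then have "card {r \<in> C. r \<in> misses_generator} \<le> card ?U"
    by (intro card_mono) auto
  also have "\<dots> \<le> n * (k * Q)"
  proof (intro card_UN_le_mult)
    fix s x
    assume x: "x \<in> {1..k}"
    show "card {r \<in> C. rotate s r \<in> ?Y x} \<le> Q"
    proof (rule card_rotate_preimage_le)
      have "{w \<in> C. w \<in> ?Y x} \<subseteq> {w \<in> reduced_words k n. x \<notin> fst ` set (take \<epsilon> w)}"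
        using relator_subset_reduced by auto
      then have "card {w \<in> C. w \<in> ?Y x} \<le> card {w \<in> reduced_words k n. x \<notin> fst ` set (take \<epsilon> w)}"
        by (intro card_mono) auto
      also have "\<dots> \<le> Q"
        using card_words_missing_letter_le[OF k _ \<epsilon>(1) x, of n] \<epsilon> by simp
      finally show "card {w \<in> C. w \<in> ?Y x} \<le> Q" .
    qed
  qed auto
  finally show ?thesis .
qed

lemma common_piece_le:
  assumes r: "r \<in> C"
  shows "card {r' \<in> C. r' \<in> common_piece r} \<le> n * (2 * n * Q)"
proof -
  let ?Y = "\<lambda>q. {w. take \<epsilon> w = take \<epsilon> q}"
  let ?U = "\<Union>s\<in>{..<n}. \<Union>q\<in>symmetrized {r}. {r' \<in> C. rotate s r' \<in> ?Y q}"
  have "{r' \<in> C. r' \<in> common_piece r} \<subseteq> ?U"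
  proof
    fix r'
    assume "r' \<in> {r' \<in> C. r' \<in> common_piece r}"
    then obtain q q' where q: "r' \<in> C" "q \<in> symmetrized {r}" "q' \<in> symmetrized {r'}" "take \<epsilon> q = take \<epsilon> q'"
      by (auto simp: common_piece_def)
    from q(1,3) show "r' \<in> ?U"
    proof (cases rule: symmetrized_cases)
      case (1 s)
      with q show ?thesis
        by (intro UN_I[of s] UN_I[of q]) auto
    next
      case (2 s)
      have len: "length q = n"
        using symmetrized_cyclically_reduced[of "{r}" n q] r q(2) by (auto simp: relator_words_iff)
      \<comment> \<open>If \<open>q'\<close> is an inverted rotation, both equal prefixes are
        inverted; they then reappear as prefixes of rotations, and \<open>?q\<close> is still in the
        symmetrized set of \<open>r\<close>.\<close>
      let ?q = "rotate (n - \<epsilon>) (inv_word q)"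
      have q2: "?q \<in> symmetrized {r}"
        using symmetrized_rotate[of "take (n - \<epsilon>) (inv_word q)" "drop (n - \<epsilon>) (inv_word q)"]
          symmetrized_inv_word[OF q(2)] len \<epsilon> by (simp add: rotate_drop_take)
      have "take \<epsilon> ?q = inv_word (take \<epsilon> q')"
        using take_rotate_inv_word[of "inv_word q" n \<epsilon>] len \<epsilon> q(4) by simp
      also have "\<dots> = take \<epsilon> (rotate ((n - \<epsilon> + s) mod n) r')"
        using take_rotate_inv_word[of "rotate s r'" n \<epsilon>] q(1) \<epsilon> 2 length_C
        by (simp add: rotate_mod rotate_rotate)
      finally show ?thesis
        using q(1) q2 n_pos by (intro UN_I[of "(n - \<epsilon> + s) mod n"] UN_I[of ?q]) auto
    qed
  qed
  moreover have fin: "finite (symmetrized {r})"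
    unfolding symmetrized_singleton[OF length_C[OF r] n_pos] by simp
  ultimately have "card {r' \<in> C. r' \<in> common_piece r} \<le> card ?U"
    by (intro card_mono) auto
  also have "\<dots> \<le> n * (2 * n * Q)"
  proof (intro card_UN_le_mult fin card_symmetrized_singleton_le[OF length_C[OF r] n_pos])
    fix s q
    show "card {r' \<in> C. rotate s r' \<in> ?Y q} \<le> Q"
    proof (rule card_rotate_preimage_le)
      show "card {w \<in> C. w \<in> ?Y q} \<le> Q"
      proof (rule card_words_determined_le[OF k, of 0])
        show "{w \<in> C. w \<in> ?Y q} \<subseteq> reduced_words k n"
          using relator_subset_reduced by auto
        fix w i
        assume "w \<in> {w \<in> C. w \<in> ?Y q}" "i < 0 + \<epsilon>"
        then show "w ! i = take \<epsilon> q ! i"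
          by (metis (mono_tags, lifting) add_0 mem_Collect_eq nth_take)
      qed (use \<epsilon> in auto)
    qed
  qed auto
  finally show ?thesis .
qed

section \<open>Coincidences within a single relator\<close>

definition shift_words :: "nat \<Rightarrow> nat word set" where
  "shift_words d = {w. take \<epsilon> (rotate d w) = take \<epsilon> w}"

text \<open>The reflection sends position \<open>i\<close> to \<open>p - i\<close>. The restriction
  \<open>i \<le> p\<close> omits wrapped positions; it costs nothing, since small \<open>p\<close>
  is impossible anyway and large \<open>p\<close> exceeds every \<open>i\<close>.\<close>

definition mirror_words :: "nat \<Rightarrow> nat word set" where
  "mirror_words p = {w. \<forall>i<\<epsilon>. i \<le> p \<longrightarrow> w ! i = inv_letter (w ! (p - i))}"

text \<open>On the window starting at \<open>d\<close> each letter repeats the one \<open>d\<close>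
  places earlier; \<open>d + \<epsilon> \<le> n\<close> keeps the window from wrapping
  around.\<close>

lemma card_shift_words_le:
  assumes "0 < d" "d + \<epsilon> \<le> n"
  shows "card {w \<in> C. w \<in> shift_words d} \<le> Q"
proof (rule card_words_determined_le[OF k assms(2) \<epsilon>(1)])
  show "{w \<in> C. w \<in> shift_words d} \<subseteq> reduced_words k n"
    using relator_subset_reduced by auto
  fix w q
  assume "w \<in> {w \<in> C. w \<in> shift_words d}" and q: "d < q" "q < d + \<epsilon>"
  then have w: "length w = n" "take \<epsilon> (rotate d w) = take \<epsilon> w"
    using length_C by (auto simp: shift_words_def)
  have "w ! q = take \<epsilon> (rotate d w) ! (q - d)"
    using w(1) q assms by (simp add: nth_rotate)
  also have "\<dots> = take q w ! (q - d)"
    unfolding w(2) using q assms by simp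
  finally show "w ! q = take q w ! (q - d)" .
qed

text \<open>
  For \<open>p < 2 \<epsilon>\<close> the centre of the reflection is reached, where a letter would have to be its own
  inverse or to follow its inverse.
\<close>

lemma card_mirror_words_le:
  assumes "p < n"
  shows "card {w \<in> C. w \<in> mirror_words p} \<le> Q"
proof (cases "p < 2 * \<epsilon>")
  case True
  have "w \<notin> mirror_words p" if "w \<in> C" for w
  proof
    assume w: "w \<in> mirror_words p"
    let ?i = "p div 2"
    have eq: "w ! ?i = inv_letter (w ! (p - ?i))"
      using w True by (simp add: mirror_words_def)
    show False
    proof (cases "even p")
      case True
      then have "p - ?i = ?i"
        by presburger
      with eq show False by simp
    next
      case False
      then have i: "p - ?i = Suc ?i" "Suc ?i < n"
        using assms by presburger+
      have "reduced w" "length w = n"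
        using that by (auto simp: relator_words_iff cyclically_reduced_def)
      then have "w ! Suc ?i \<noteq> inv_letter (w ! ?i)"
        using i(2) by (simp add: reduced_def successively_conv_nth)
      with eq i(1) show False by simp
    qed
  qed
  then have "{w \<in> C. w \<in> mirror_words p} = {}"
    by blast
  then show ?thesis
    by (simp only: card.empty)
next
  case False
  show ?thesis
  proof (rule card_words_determined_le[OF k _ \<epsilon>(1)])
    \<comment> \<open>The window is the mirror image of the first \<epsilon> positions and ends at
      \<open>p\<close>. Because of \<open>2 * \<epsilon> \<le> p\<close> it lies to the right of
      them, so its letters are determined by earlier ones.\<close>
    show "p - \<epsilon> + 1 + \<epsilon> \<le> n"
      using assms False by simp
    show "{w \<in> C. w \<in> mirror_words p} \<subseteq> reduced_words k n"
      using relator_subset_reduced by auto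
    fix w q
    assume w: "w \<in> {w \<in> C. w \<in> mirror_words p}" and q: "p - \<epsilon> + 1 < q" "q < p - \<epsilon> + 1 + \<epsilon>"
    then have i: "p - q < \<epsilon>" "p - q \<le> p" "p - (p - q) = q" "p - q < q"
      using False by auto
    then have "w ! (p - q) = inv_letter (w ! q)"
      using w unfolding mirror_words_def by fastforce
    then show "w ! q = inv_letter (take q w ! (p - q))"
      using i(4) by simp
  qed
qed

text \<open>Equal prefixes read in the same direction give a shift, in opposite directions a
  reflection. Two inverted readings are first turned into two direct ones.\<close>

lemma self_piece_le: "card {r \<in> C. r \<in> self_piece} \<le> n * (n * Q) + n * (n * Q)"
proof -
  let ?U = "\<Union>s\<in>{..<n}. \<Union>d\<in>{1..n - \<epsilon>}. {r \<in> C. rotate s r \<in> shift_words d}"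
  let ?V = "\<Union>s\<in>{..<n}. \<Union>p\<in>{..<n}. {r \<in> C. rotate s r \<in> mirror_words p}"
  have shift: "r \<in> ?U" if r: "r \<in> C" and neq: "rotate s r \<noteq> rotate t r"
    and eq: "take \<epsilon> (rotate s r) = take \<epsilon> (rotate t r)" and st: "s < n" "t < n" for r s t
  proof -
    have ordered: "r \<in> ?U"
      if st: "s < t" "t < n" and eq: "take \<epsilon> (rotate s r) = take \<epsilon> (rotate t r)" for s t
    proof (cases "t - s + \<epsilon> \<le> n")
      case True
      have "rotate (t - s) (rotate s r) = rotate t r"
        using st by (simp add: rotate_rotate)
      then have "rotate s r \<in> shift_words (t - s)"
        using eq by (simp add: shift_words_def)
      then show ?thesis
        using r st True by (intro UN_I[of s] UN_I[of "t - s"]) auto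
    next
      case False
      \<comment> \<open>If the later window would wrap around, the comparison starts at
        \<open>t\<close> instead, with shift \<open>n - (t - s)\<close>; this shift is admissible
        because \<open>2 * \<epsilon> \<le> n\<close>.\<close>
      have "rotate (n - (t - s)) (rotate t r) = rotate (n + s) r"
        using st by (simp add: rotate_rotate)
      also have "\<dots> = rotate s r"
        using rotate_mod[OF r, of "n + s"] rotate_mod[OF r, of s] by simp
      finally have "rotate (n - (t - s)) (rotate t r) = rotate s r" .
      then have "rotate t r \<in> shift_words (n - (t - s))"
        using eq st r by (simp add: shift_words_def)
      moreover have "n - (t - s) \<in> {1..n - \<epsilon>}"
        using False st \<epsilon> by auto
      ultimately show ?thesis
        using r st by (intro UN_I[of t] UN_I[of "n - (t - s)"]) auto
    qed
    show ?thesis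
      using ordered[of s t] ordered[of t s] st eq neq by (cases s t rule: linorder_cases) auto
  qed
  have mirror: "r \<in> ?V" if r: "r \<in> C" and st: "s < n" "t < n"
    and eq: "take \<epsilon> (rotate s r) = take \<epsilon> (inv_word (rotate t r))" for r s t
  proof -
    define u where "u = rotate s r"
    \<comment> \<open>Letter \<open>i\<close> of \<open>u\<close> faces letter
      \<open>n - 1 - i\<close> of the rotation of \<open>u\<close> by \<open>t - s\<close>, that is,
      position \<open>p - i\<close> modulo \<open>n\<close>. The first added \<open>n\<close> keeps
      the subtraction of \<open>s\<close> from being truncated.\<close>
    define p where "p = (t + n - s + n - 1) mod n"
    have u: "length u = n"
      using r length_C by (simp add: u_def)
    have rt: "rotate t r = rotate (t + n - s) u"
      using rotate_mod[OF r, of "t + n"] rotate_mod[OF r, of t] st by (simp add: u_def rotate_rotate)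
    have "u ! i = inv_letter (u ! (p - i))" if i: "i < \<epsilon>" "i \<le> p" for i
    proof -
      have "u ! i = take \<epsilon> (inv_word (rotate t r)) ! i"
        using eq i by (metis nth_take u_def)
      also have "\<dots> = inv_letter (rotate (t + n - s) u ! (n - 1 - i))"
        using i \<epsilon> u by (simp add: rt inv_word_def rev_nth)
      also have "rotate (t + n - s) u ! (n - 1 - i) = u ! ((t + n - s + (n - 1 - i)) mod n)"
        using u n_pos by (simp add: nth_rotate)
      also have "(t + n - s + (n - 1 - i)) mod n = p - i"
      proof -
        have "t + n - s + (n - 1 - i) = t + n - s + n - 1 - i"
          using i \<epsilon> by simp
        also have "\<dots> = (t + n - s + n - 1) div n * n + (p - i)"
          using i(2) div_mult_mod_eq[of "t + n - s + n - 1" n] unfolding p_def by linarith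
        also have "\<dots> mod n = p - i"
          using n_pos by (simp add: p_def less_imp_diff_less)
        finally show ?thesis .
      qed
      finally show ?thesis .
    qed
    then have "u \<in> mirror_words p"
      by (simp add: mirror_words_def)
    then show ?thesis
      using r st n_pos unfolding u_def by (intro UN_I[of s] UN_I[of p]) (auto simp: p_def)
  qed
  have "{r \<in> C. r \<in> self_piece} \<subseteq> ?U \<union> ?V"
  proof
    fix r
    assume "r \<in> {r \<in> C. r \<in> self_piece}"
    then obtain q q' where r: "r \<in> C" and q: "q \<in> symmetrized {r}" "q' \<in> symmetrized {r}"
      "q \<noteq> q'" "take \<epsilon> q = take \<epsilon> q'"
      by (auto simp: self_piece_def)
    from r q(1) show "r \<in> ?U \<union> ?V"
    proof (cases rule: symmetrized_cases)
      case s: (1 s)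
      from r q(2) show ?thesis
      proof (cases rule: symmetrized_cases)
        case (1 t)
        then show ?thesis
          using shift[OF r, of s t] s q by auto
      next
        case (2 t)
        then show ?thesis
          using mirror[OF r, of s t] s q by auto
      qed
    next
      case s: (2 s)
      from r q(2) show ?thesis
      proof (cases rule: symmetrized_cases)
        case (1 t)
        then show ?thesis
          using mirror[OF r, of t s] s q by auto
      next
        case t: (2 t)
        have "take \<epsilon> (rotate (n - \<epsilon> + s) r) = take \<epsilon> (rotate (n - \<epsilon> + t) r)"
          using take_rotate_inv_word[of "rotate s r" n \<epsilon>] take_rotate_inv_word[of "rotate t r" n \<epsilon>]
            s t q(4) \<epsilon> r length_C by (simp add: rotate_rotate)
        moreover have "rotate (n - \<epsilon> + s) r \<noteq> rotate (n - \<epsilon> + t) r"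
          using q(3) s t injD[OF inj_rotate[of "n - \<epsilon>"], of "rotate s r" "rotate t r"]
          by (auto simp: rotate_rotate)
        ultimately show ?thesis
          using shift[OF r, of "(n - \<epsilon> + s) mod n" "(n - \<epsilon> + t) mod n"] n_pos
          by (simp add: rotate_mod[OF r])
      qed
    qed
  qed
  then have "card {r \<in> C. r \<in> self_piece} \<le> card (?U \<union> ?V)"
    by (intro card_mono) auto
  also have "\<dots> \<le> card ?U + card ?V"
    by (rule card_Un_le)
  also have "card ?U \<le> n * (n * Q)"
  proof (intro card_UN_le_mult)
    fix s d
    assume "d \<in> {1..n - \<epsilon>}"
    then show "card {r \<in> C. rotate s r \<in> shift_words d} \<le> Q"
      using \<epsilon> by (intro card_rotate_preimage_le[OF _ card_shift_words_le[of d]]) auto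
  qed auto
  also have "card ?V \<le> n * (n * Q)"
  proof (intro card_UN_le_mult)
    fix s p
    assume "p \<in> {..<n}"
    then show "card {r \<in> C. rotate s r \<in> mirror_words p} \<le> Q"
      by (intro card_rotate_preimage_le[OF _ card_mirror_words_le[of p]]) auto
  qed auto
  finally show ?thesis
    by simp
qed

end


section \<open>Random presentations\<close>

lemma symmetrized_elem:
  assumes "q \<in> symmetrized X"
  obtains r where "r \<in> X" "q \<in> symmetrized {r}"
  using assms unfolding symmetrized_def by blast

context window
begin

lemma card_not_free_le:
  assumes n: "8 * \<epsilon> < n" and m: "1 \<le> m"
  shows "card {rs. length rs = m \<and> set rs \<subseteq> C \<and> \<not> proper_subsets_free k rs}
    \<le> m * (card C ^ (m - 1) * (m * ((k + 4) * n\<^sup>2 * Q)))"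
proof -
  \<comment> \<open>A relator is bad relative to the others if it is bad alone or shares a piece
    with one of them. One factor \<open>m\<close> in the bound counts the coordinate, the other the
    possible partners.\<close>
  define F where "F rest = misses_generator \<union> self_piece \<union> (\<Union>r\<in>set rest. common_piece r)"
    for rest :: "nat word list"
  let ?F = "{rs. length rs = m \<and> set rs \<subseteq> C \<and> (\<exists>i<m. rs ! i \<in> F (take i rs @ drop (Suc i) rs))}"
  have "{rs. length rs = m \<and> set rs \<subseteq> C \<and> \<not> proper_subsets_free k rs} \<subseteq> ?F"
  proof
    fix rs
    assume rs: "rs \<in> {rs. length rs = m \<and> set rs \<subseteq> C \<and> \<not> proper_subsets_free k rs}"
    show "rs \<in> ?F"
    proof (rule ccontr)
      assume not: "rs \<notin> ?F"
      have good: "r \<notin> misses_generator" "r \<notin> self_piece" if "r \<in> set rs" for r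
        using that not rs by (auto simp: F_def in_set_conv_nth)
      have common: "r' \<notin> common_piece r" if r: "r \<in> set rs" "r' \<in> set rs" "r \<noteq> r'" for r r'
      proof -
        obtain i j where ij: "i < m" "rs ! i = r'" "j < m" "rs ! j = r"
          using r rs by (auto simp: in_set_conv_nth)
        with r(3) have "i \<noteq> j" by auto
        have "r \<in> set (take i rs @ drop (Suc i) rs)"
        proof (cases "j < i")
          case True
          then show ?thesis
            using ij rs nth_mem[of j "take i rs"] by auto
        next
          case False
          then have "drop (Suc i) rs ! (j - Suc i) = r" "j - Suc i < length (drop (Suc i) rs)"
            using ij \<open>i \<noteq> j\<close> rs by auto
          then show ?thesis
            using nth_mem[of "j - Suc i" "drop (Suc i) rs"] by simp
        qed
        moreover have "rs ! i \<notin> F (take i rs @ drop (Suc i) rs)"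
          using not rs ij(1) by blast
        ultimately show ?thesis
          using ij(2) unfolding F_def by blast
      qed
      have "proper_subsets_free k rs"
      proof (rule proper_subsets_freeI[OF _ \<epsilon>(1) n])
        show "set rs \<subseteq> {w \<in> cyclically_reduced_words k. length w = n}"
          using rs by (simp add: relator_words_def)
        fix q
        assume q: "q \<in> symmetrized (set rs)"
        then obtain r where r: "r \<in> set rs" "q \<in> symmetrized {r}"
          by (rule symmetrized_elem)
        then show "{1..k} \<subseteq> fst ` set (take \<epsilon> q)"
          using good(1)[OF r(1)] unfolding misses_generator_def by blast
        fix q'
        assume "q' \<in> symmetrized (set rs)" and eq: "take \<epsilon> q = take \<epsilon> q'"
        then obtain r' where r': "r' \<in> set rs" "q' \<in> symmetrized {r'}"
          by (blast elim: symmetrized_elem)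
        have "r = r'"
          using common[OF r(1) r'(1)] r(2) r'(2) eq unfolding common_piece_def by blast
        then show "q = q'"
          using good(2)[OF r(1)] r(2) r'(2) eq unfolding self_piece_def by blast
      qed
      with rs show False by simp
    qed
  qed
  moreover have "finite ?F"
    by (rule finite_subset[OF _ finite_lists_length_eq[of C m]]) auto
  ultimately have "card {rs. length rs = m \<and> set rs \<subseteq> C \<and> \<not> proper_subsets_free k rs} \<le> card ?F"
    by (rule card_mono[rotated])
  also have "\<dots> \<le> m * (card C ^ (m - 1) * (m * ((k + 4) * n\<^sup>2 * Q)))"
  proof (rule card_lists_coordinate)
    fix rest :: "nat word list"
    assume rest: "set rest \<subseteq> C" "length rest = m - 1"
    let ?M = "{x \<in> C. x \<in> misses_generator}" and ?S = "{x \<in> C. x \<in> self_piece}"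
      and ?P = "\<Union>r\<in>set rest. {x \<in> C. x \<in> common_piece r}"
    have "{x \<in> C. x \<in> F rest} = (?M \<union> ?S) \<union> ?P"
      by (auto simp: F_def)
    then have "card {x \<in> C. x \<in> F rest} \<le> card ?M + card ?S + card ?P"
      using card_Un_le[of "?M \<union> ?S" ?P] card_Un_le[of ?M ?S] by simp
    also have "\<dots> \<le> n * (k * Q) + (n * (n * Q) + n * (n * Q)) + (m - 1) * (n * (2 * n * Q))"
    proof (intro add_mono misses_generator_le self_piece_le)
      show "card ?P \<le> (m - 1) * (n * (2 * n * Q))"
        using rest card_length[of rest] by (intro card_UN_le_mult common_piece_le) auto
    qed
    \<comment> \<open>The sum \<open>k + 4\<close> collects \<open>k\<close> from missed generators,
      2 from self pieces and 2 from common pieces.\<close>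
    also have "\<dots> \<le> m * (n * n * k * Q) + m * (2 * n * n * Q) + m * (2 * n * n * Q)"
    proof (intro add_mono)
      have "1 * (1 * n * k * Q) \<le> m * (n * n * k * Q)"
        using m n_pos by (intro mult_mono) auto
      then show "n * (k * Q) \<le> m * (n * n * k * Q)"
        by (simp add: mult.assoc)
      have "n * (n * Q) + n * (n * Q) = 1 * (2 * n * n * Q)"
        by simp
      also have "\<dots> \<le> m * (2 * n * n * Q)"
        using m by (intro mult_mono) auto
      finally show "n * (n * Q) + n * (n * Q) \<le> m * (2 * n * n * Q)" .
      have "(m - 1) * (2 * n * n * Q) \<le> m * (2 * n * n * Q)"
        by (intro mult_mono) auto
      then show "(m - 1) * (n * (2 * n * Q)) \<le> m * (2 * n * n * Q)"
        by (simp add: mult.assoc mult.left_commute)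
    qed
    also have "\<dots> = m * ((k + 4) * n\<^sup>2 * Q)"
      by (simp add: algebra_simps power2_eq_square)
    finally show "card {x \<in> C. x \<in> F rest} \<le> m * ((k + 4) * n\<^sup>2 * Q)" .
  qed simp
  finally show ?thesis .
qed

text \<open>The last factor is the lower bound for the number of relators, so the remaining factors
  bound the probability of a single coincidence.\<close>

lemma window_bound_eq:
  "real Q = 2 * real k * ((2 * real k - 3) / (2 * real k - 1)) ^ (\<epsilon> - 1) * (2 * real k - 1) ^ (n - 1)"
proof -
  have "n - 1 = (n - \<epsilon>) + (\<epsilon> - 1)"
    using \<epsilon> by simp
  then have "(2 * real k - 1) ^ (n - 1) = (2 * real k - 1) ^ (n - \<epsilon>) * (2 * real k - 1) ^ (\<epsilon> - 1)"
    by (simp add: power_add)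
  then show ?thesis
    using k by (simp add: window_bound_def of_nat_diff power_divide)
qed

lemma free_ratio_ge:
  assumes n: "8 * \<epsilon> < n" and m: "1 \<le> m"
  shows "1 - (real m)\<^sup>2 * (2 * real k * (real k + 4)) * (real n)\<^sup>2 *
        ((2 * real k - 3) / (2 * real k - 1)) ^ (\<epsilon> - 1)
    \<le> real (card {rs. length rs = m \<and> set rs \<subseteq> C \<and> proper_subsets_free k rs}) / real (card C) ^ m"
proof -
  let ?A = "{rs. length rs = m \<and> set rs \<subseteq> C}"
  let ?G = "{rs. length rs = m \<and> set rs \<subseteq> C \<and> proper_subsets_free k rs}"
  let ?B = "{rs. length rs = m \<and> set rs \<subseteq> C \<and> \<not> proper_subsets_free k rs}"
  let ?\<rho> = "((2 * real k - 3) / (2 * real k - 1)) ^ (\<epsilon> - 1)"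
  have A: "finite ?A" "card ?A = card C ^ m"
    using finite_lists_length_eq[of C m] card_lists_length_eq[of C m] by (simp_all add: conj_commute)
  have "?A = ?G \<union> ?B" "?G \<inter> ?B = {}"
    by auto
  moreover have "finite ?G" "finite ?B"
    by (auto intro: finite_subset[OF _ A(1)])
  ultimately have "card ?G + card ?B = card C ^ m"
    using card_Un_disjoint[of ?G ?B] A(2) by simp
  then have "real (card ?G) + real (card ?B) = real (card C) ^ m"
    by (simp only: of_nat_add[symmetric] of_nat_power[symmetric])
  then have G: "real (card ?G) = real (card C) ^ m - real (card ?B)"
    by (rule eq_diff_eq[THEN iffD2])
  have "(2 * k - 1) ^ (n - 1) \<le> card C"
    using card_relator_words_ge[OF k] n_pos by simp
  moreover have "real ((2 * k - 1) ^ (n - 1)) = (2 * real k - 1) ^ (n - 1)"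
    using k by (simp add: of_nat_diff)
  ultimately have C: "(2 * real k - 1) ^ (n - 1) \<le> real (card C)"
    by (metis of_nat_le_iff)
  have L: "(2 * real k - 1) ^ (n - 1) > 0" and \<rho>: "?\<rho> \<ge> 0"
    using k by auto
  have Q: "real Q \<le> 2 * real k * ?\<rho> * real (card C)"
    unfolding window_bound_eq by (rule mult_left_mono[OF C]) (use \<rho> in simp)
  have "real (card ?B) \<le> real (m * (card C ^ (m - 1) * (m * ((k + 4) * n\<^sup>2 * Q))))"
    using card_not_free_le[OF n m] by (simp only: of_nat_le_iff)
  also have "\<dots> = real m * (real (card C) ^ (m - 1) * (real m * ((real k + 4) * (real n)\<^sup>2 * real Q)))"
    by simp
  also have "\<dots> \<le> real m * (real (card C) ^ (m - 1) * (real m * ((real k + 4) * (real n)\<^sup>2 *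
      (2 * real k * ?\<rho> * real (card C)))))"
    by (intro mult_left_mono Q) auto
  also have "\<dots> = ((real m)\<^sup>2 * (2 * real k * (real k + 4)) * (real n)\<^sup>2 * ?\<rho>) *
      (real (card C) ^ (m - 1) * real (card C))"
    by (simp add: power2_eq_square)
  also have "real (card C) ^ (m - 1) * real (card C) = real (card C) ^ m"
    using m by (simp add: power_eq_if)
  finally have "real (card ?B) \<le>
    ((real m)\<^sup>2 * (2 * real k * (real k + 4)) * (real n)\<^sup>2 * ?\<rho>) * real (card C) ^ m" .
  moreover have "real (card C) ^ m > 0"
    using C L by simp
  moreover have "1 - c \<le> (x - b) / x" if "b \<le> c * x" "x > 0" for b c x :: real
    using that by (simp add: field_simps)
  ultimately show ?thesis
    unfolding G by blast
qed

end

text \<open>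
  With \<open>\<rho> = (2 k - 3) / (2 k - 1)\<close>, this is the density at which the square of the number of
  relators is \<open>\<rho>\<close> to the power \<open>- n / 18\<close>, against a bound of order \<open>\<rho>\<close> to the power
  \<open>n / 9\<close> for the probability of a single bad coincidence.
\<close>

definition threshold_density :: "nat \<Rightarrow> real" where
  "threshold_density k =
     ln ((2 * real k - 1) / (2 * real k - 3)) / (36 * ln (2 * real k - 1))"

lemma threshold_density_bounds:
  assumes "k \<ge> 2"
  shows "0 < threshold_density k" "threshold_density k < 1"
proof -
  let ?L = "2 * real k - 1" and ?l = "2 * real k - 3"
  have L: "?L \<ge> 3" "?l \<ge> 1"
    using assms by simp_all
  then have pos: "ln ?L > 0" "ln (?L / ?l) > 0"
    by simp_all
  have "ln (?L / ?l) \<le> ln ?L"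
    using L by (simp add: ln_div)
  also have "\<dots> < 36 * ln ?L"
    using pos by simp
  finally show "0 < threshold_density k" "threshold_density k < 1"
    using pos by (simp_all add: threshold_density_def)
qed

lemma proper_subsets_free_limit:
  assumes k: "k \<ge> 2" and d: "0 < d" "d \<le> threshold_density k"
  shows "(\<lambda>n. real (num_presentations k n d (proper_subsets_free k)) /
      real (num_words n (cyclically_reduced_words k)) ^ num_relators k n d) \<longlonglongrightarrow> 1"
proof -
  let ?L = "2 * real k - 1" and ?l = "2 * real k - 3"
  define a where "a = ln (?L / ?l)"
  \<comment> \<open>The factor \<open>exp (2 * a)\<close> absorbs the loss in
    \<open>\<epsilon> - 1 \<ge> n / 9 - 2\<close>.\<close>
  define K where "K = 2 * real k * (real k + 4) * exp (2 * a)"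
  \<comment> \<open>The exponents \<open>n * a / 18\<close> and \<open>- n * a / 9\<close> add up to
    \<open>- n * a / 18\<close>. Half of this rate makes the whole error a constant times the square
    of \<open>n * y ^ n\<close>, which tends to 0.\<close>
  define y where "y = exp (- a / 36)"
  have L: "?L \<ge> 3" "?l \<ge> 1"
    using k by simp_all
  then have a: "a > 0"
    by (simp add: a_def)
  have \<rho>: "?l / ?L = exp (- a)"
    using L by (simp add: a_def exp_minus)
  let ?g = "\<lambda>n. real (num_presentations k n d (proper_subsets_free k)) /
      real (num_words n (cyclically_reduced_words k)) ^ num_relators k n d"
  have upper: "?g n \<le> 1" for n
  proof -
    let ?A = "{rs. set rs \<subseteq> relator_words k n \<and> length rs = num_relators k n d}"
    have "num_presentations k n d (proper_subsets_free k) \<le> card ?A"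
      unfolding num_presentations_def relator_words_def[symmetric]
      by (rule card_mono) (auto simp: finite_lists_length_eq)
    also have "\<dots> = num_words n (cyclically_reduced_words k) ^ num_relators k n d"
      by (simp add: card_lists_length_eq num_words_def relator_words_def[symmetric])
    finally have "real (num_presentations k n d (proper_subsets_free k)) \<le>
        real (num_words n (cyclically_reduced_words k)) ^ num_relators k n d"
      by (metis of_nat_le_iff of_nat_power)
    then show ?thesis
      by (cases "num_words n (cyclically_reduced_words k) ^ num_relators k n d = 0") auto
  qed
  have lower: "1 - K * (real n * y ^ n)\<^sup>2 \<le> ?g n" if n: "n \<ge> 9" for n
  proof -
    \<comment> \<open>A fraction of \<open>n\<close> below one eighth, as
      \<open>8 * \<epsilon> < n\<close> demands; \<open>n \<ge> 9\<close> makes it positive.\<close>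
    define \<epsilon> where "\<epsilon> = n div 9"
    define m where "m = num_relators k n d"
    have eps: "0 < \<epsilon>" "2 * \<epsilon> \<le> n" "8 * \<epsilon> < n" "real \<epsilon> \<ge> real n / 9 - 1"
      using n by (auto simp: \<epsilon>_def)
    interpret window k n \<epsilon>
      by unfold_locales (use k eps in auto)
    have "?L powr (real n * d) \<ge> 1"
      using L d by (intro ge_one_powr_ge_zero) auto
    then have m: "1 \<le> m" "real m \<le> ?L powr (real n * d)"
      by (simp_all add: m_def num_relators_def le_nat_iff)
    have "2 * real n * d * ln ?L \<le> 2 * real n * threshold_density k * ln ?L"
      using L d by (intro mult_right_mono mult_left_mono) auto
    also have "\<dots> = real n * a / 18"
      using L by (simp add: threshold_density_def a_def)
    finally have dn: "2 * real n * d * ln ?L \<le> real n * a / 18" .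
    have "(real m)\<^sup>2 \<le> (?L powr (real n * d))\<^sup>2"
      using m by (intro power_mono) auto
    also have "\<dots> = exp (2 * real n * d * ln ?L)"
      using L by (simp add: powr_def power2_eq_square exp_add[symmetric])
    also have "\<dots> \<le> exp (real n * a / 18)"
      using dn by simp
    finally have m2: "(real m)\<^sup>2 \<le> exp (real n * a / 18)" .
    have "real (\<epsilon> - 1) = real \<epsilon> - 1"
      using eps(1) by (simp add: of_nat_diff)
    then have "(?l / ?L) ^ (\<epsilon> - 1) = exp (- a * (real \<epsilon> - 1))"
      unfolding \<rho> by (simp add: exp_of_nat_mult[symmetric] mult.commute)
    also have "\<dots> \<le> exp (- a * (real n / 9 - 2))"
      using a eps(4) by simp
    finally have r: "(?l / ?L) ^ (\<epsilon> - 1) \<le> exp (- a * (real n / 9 - 2))" .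
    have "(real m)\<^sup>2 * (2 * real k * (real k + 4)) * (real n)\<^sup>2 * (?l / ?L) ^ (\<epsilon> - 1) \<le>
        exp (real n * a / 18) * (2 * real k * (real k + 4)) * (real n)\<^sup>2 * exp (- a * (real n / 9 - 2))"
      using m2 r L by (intro mult_mono) auto
    also have "\<dots> = 2 * real k * (real k + 4) * (real n)\<^sup>2 *
        (exp (real n * a / 18) * exp (- a * (real n / 9 - 2)))"
      by simp
    also have "exp (real n * a / 18) * exp (- a * (real n / 9 - 2)) = exp (2 * a) * (y ^ n)\<^sup>2"
      unfolding y_def power2_eq_square exp_of_nat_mult[symmetric] exp_add[symmetric]
      by (simp add: field_simps)
    finally have "(real m)\<^sup>2 * (2 * real k * (real k + 4)) * (real n)\<^sup>2 * (?l / ?L) ^ (\<epsilon> - 1) \<le>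
        K * (real n * y ^ n)\<^sup>2"
      by (simp add: K_def power_mult_distrib ac_simps)
    then have "1 - K * (real n * y ^ n)\<^sup>2 \<le>
        1 - (real m)\<^sup>2 * (2 * real k * (real k + 4)) * (real n)\<^sup>2 * (?l / ?L) ^ (\<epsilon> - 1)"
      by simp
    also have "\<dots> \<le> ?g n"
      using free_ratio_ge[OF eps(3) m(1)]
      by (simp add: num_presentations_def num_words_def relator_words_def m_def)
    finally show ?thesis .
  qed
  have "(\<lambda>n. real n * y ^ n) \<longlonglongrightarrow> 0"
    by (rule powser_times_n_limit_0) (use a in \<open>simp add: y_def\<close>)
  then have "(\<lambda>n. 1 - K * (real n * y ^ n)\<^sup>2) \<longlonglongrightarrow> 1 - K * 0\<^sup>2"
    by (intro tendsto_intros)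
  then have lim: "(\<lambda>n. 1 - K * (real n * y ^ n)\<^sup>2) \<longlonglongrightarrow> 1"
    by simp
  show ?thesis
  proof (rule tendsto_sandwich[OF _ _ lim tendsto_const])
    show "\<forall>\<^sub>F n in sequentially. 1 - K * (real n * y ^ n)\<^sup>2 \<le> ?g n"
      using lower by (rule eventually_sequentiallyI)
    show "\<forall>\<^sub>F n in sequentially. ?g n \<le> 1"
      using upper by simp
  qed
qed

section \<open>Failure at a fixed density\<close>

lemma relator_in_subset_not_free:
  assumes rs: "set rs \<subseteq> carrier (free_group X)" and r: "r \<in> set rs" "r \<noteq> []"
    and S: "S \<subseteq> X" "fst ` set r \<subseteq> S"
  shows "\<not> freely_generates (presented_group X rs) (presented_gen X rs) S"
proof
  interpret F: group "free_group X"
    by (rule group_free_group)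
  let ?N = "normal_closure (free_group X) (set rs)"
  interpret N: normal ?N "free_group X"
    by (rule F.normal_normal_closure[OF rs])
  let ?h = "word_value (presented_group X rs) (presented_gen X rs)"
  assume "freely_generates (presented_group X rs) (presented_gen X rs) S"
  then have inj: "inj_on ?h (carrier (free_group S))"
    by (simp add: freely_generates_def iso_def bij_betw_def)
  have red: "r \<in> carrier (free_group X)"
    using rs r(1) by blast
  then have "reduced r"
    by (simp add: carrier_free_group)
  note red = this red
  have "r \<in> ?N"
    using r(1) by (auto simp: normal_closure_def)
  then have "?h r = ?N"
    using word_value_presented_group[OF rs, of r] S red F.coset_join2[OF red(2) N.subgroup_axioms]
    by (auto simp: reduce_reduced)
  moreover have "?h [] = ?N"
    by (simp add: presented_group_def FactGroup_def)
  ultimately have "r = []"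
    using inj_onD[OF inj, of r "[]"] red S by (simp add: carrier_free_group)
  with r(2) show False by simp
qed

lemma positive_word_cyclically_reduced:
  assumes "\<And>l. l \<in> set w \<Longrightarrow> snd l"
  shows "cyclically_reduced w"
proof -
  have neq: "l' \<noteq> inv_letter l" if "snd l" "snd l'" for l l' :: "'a letter"
    using that by (auto simp: inv_letter_def)
  have "reduced w"
    using assms
  proof (induction w)
    case (Cons l w)
    then show ?case
      by (cases w) (simp_all add: reduced_Cons neq)
  qed simp
  then show ?thesis
    using neq assms by (simp add: cyclically_reduced_def)
qed

text \<open>Positive words are cyclically reduced, so all \<open>(k - 1) ^ n\<close> of them over
  the first \<open>k - 1\<close> generators are possible relators. A presentation with the property
  has to avoid them in every coordinate.\<close>

lemma num_presentations_free_le: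
  assumes k: "k \<ge> 2" and n: "n \<ge> 1"
  shows "num_presentations k n d (proper_subsets_free k) \<le>
    (card (relator_words k n) - (k - 1) ^ n) ^ num_relators k n d"
proof -
  let ?C = "relator_words k n"
  define P :: "nat word set" where "P = {w. set w \<subseteq> {1..k - 1} \<times> {True} \<and> length w = n}"
  have fin: "finite P" and card_P: "card P = (k - 1) ^ n"
    unfolding P_def by (simp_all add: finite_lists_length_eq card_lists_length_eq)
  have P: "cyclically_reduced w \<and> fst ` set w \<subseteq> {1..k - 1}" if "w \<in> P" for w
  proof
    show "cyclically_reduced w"
      by (rule positive_word_cyclically_reduced) (use that in \<open>auto simp: P_def\<close>)
    show "fst ` set w \<subseteq> {1..k - 1}"
      using that by (fastforce simp: P_def)
  qed
  have PC: "P \<subseteq> ?C"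
  proof
    fix w
    assume "w \<in> P"
    then have "fst ` set w \<subseteq> {1..k - 1}" "cyclically_reduced w" "length w = n"
      using P[of w] by (auto simp: P_def)
    moreover have "{1..k - 1} \<subseteq> {1..k}"
      by auto
    ultimately have "fst ` set w \<subseteq> {1..k}" "cyclically_reduced w" "length w = n"
      by blast+
    then show "w \<in> ?C"
      unfolding relator_words_iff letters_iff by blast
  qed
  let ?m = "num_relators k n d"
  have "{rs. length rs = ?m \<and> set rs \<subseteq> ?C \<and> proper_subsets_free k rs} \<subseteq>
      {rs. set rs \<subseteq> ?C - P \<and> length rs = ?m}"
  proof
    fix rs
    assume rs: "rs \<in> {rs. length rs = ?m \<and> set rs \<subseteq> ?C \<and> proper_subsets_free k rs}"
    have "r \<notin> P" if "r \<in> set rs" for r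
    proof
      assume "r \<in> P"
      have "set rs \<subseteq> carrier (free_group {1..k})"
        using rs by (auto simp: relator_words_def cyclically_reduced_words_def)
      then have "\<not> freely_generates (presented_group {1..k} rs) (presented_gen {1..k} rs) {1..k - 1}"
        by (rule relator_in_subset_not_free[where r = r])
          (use that P[OF \<open>r \<in> P\<close>] \<open>r \<in> P\<close> n in \<open>auto simp: P_def\<close>)
      moreover have "{1..k - 1} \<subset> {1..k}"
        using k by auto
      ultimately show False
        using rs unfolding proper_subsets_free_def by blast
    qed
    with rs show "rs \<in> {rs. set rs \<subseteq> ?C - P \<and> length rs = ?m}"
      by blast
  qed
  then have "num_presentations k n d (proper_subsets_free k) \<le>
      card {rs. set rs \<subseteq> ?C - P \<and> length rs = ?m}"
    unfolding num_presentations_def relator_words_def[symmetric]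
    by (intro card_mono) (auto simp: finite_lists_length_eq)
  also have "\<dots> = (card ?C - (k - 1) ^ n) ^ ?m"
    using card_Diff_subset[OF fin PC] by (simp add: card_lists_length_eq card_P)
  finally show ?thesis .
qed

lemma not_density_random:
  assumes d: "0 < d"
  shows "\<not> density_random d proper_subsets_free"
proof
  assume rand: "density_random d proper_subsets_free"
  \<comment> \<open>Chosen so that \<open>4 powr (1 / d) \<le> k \<le> 2 * k - 1\<close>; adding 2
    ensures \<open>k \<ge> 2\<close> for every \<open>d\<close>.\<close>
  define k where "k = nat \<lceil>4 powr (1 / d)\<rceil> + 2"
  have k: "k \<ge> 2"
    by (simp add: k_def)
  let ?L = "2 * real k - 1"
  have "4 powr (1 / d) \<le> real k"
    unfolding k_def by linarith
  then have "4 powr (1 / d) \<le> ?L"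
    using k by linarith
  then have "(4 powr (1 / d)) powr d \<le> ?L powr d"
    using d by (intro powr_mono2) auto
  then have Ld: "4 \<le> ?L powr d"
    using d by (simp add: powr_powr)
  let ?g = "\<lambda>n. real (num_presentations k n d (proper_subsets_free k)) /
      real (num_words n (cyclically_reduced_words k)) ^ num_relators k n d"
  have "?g n \<le> exp (- 1)" if n: "n \<ge> 1" for n
  proof -
    let ?C = "real (card (relator_words k n))" and ?P = "real (k - 1) ^ n"
    define m where "m = num_relators k n d"
    have "(4::real) ^ n \<le> (?L powr d) ^ n"
      using Ld by (intro power_mono) auto
    also have "\<dots> = ?L powr (real n * d)"
      using k by (simp add: powr_realpow[symmetric] powr_powr mult.commute)
    finally have "real_of_int (4 ^ n) \<le> ?L powr (real n * d)"
      by simp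
    then have "(4::int) ^ n \<le> \<lfloor>?L powr (real n * d)\<rfloor>"
      by (simp only: le_floor_iff)
    then have "int (4 ^ n) \<le> \<lfloor>?L powr (real n * d)\<rfloor>"
      by simp
    then have "4 ^ n \<le> m"
      unfolding m_def num_relators_def by linarith
    then have m: "4 ^ n \<le> real m"
      by (metis of_nat_le_iff of_nat_numeral of_nat_power)
    have C: "?C > 0"
      using card_relator_words_ge[OF k n] k by (simp add: Suc_le_eq order.strict_trans2[of 0 "(2 * k - 1) ^ (n - 1)"])
    have "?C \<le> (2 * real k) ^ n"
      using card_relator_words_le[of k n] by (metis of_nat_le_iff of_nat_mult of_nat_numeral of_nat_power)
    \<comment> \<open>The origin of the 4: \<open>2 * k \<le> 4 * (k - 1)\<close> for
      \<open>k \<ge> 2\<close>. A random relator is thus positive of the required kind with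
      probability at least \<open>1 / 4 ^ n\<close>, and with at least \<open>4 ^ n\<close> relators
      the expected number of such relators is at least 1.\<close>
    also have "\<dots> \<le> (4 * real (k - 1)) ^ n"
      using k by (intro power_mono) (auto simp: of_nat_diff)
    also have "\<dots> = 4 ^ n * ?P"
      by (simp add: power_mult_distrib)
    also have "\<dots> \<le> real m * ?P"
      using m by (intro mult_right_mono) auto
    finally have mP: "1 \<le> real m * (?P / ?C)"
      using C by (simp add: field_simps)
    have num: "real (num_presentations k n d (proper_subsets_free k)) \<le> real ((card (relator_words k n) - (k - 1) ^ n) ^ m)"
      using num_presentations_free_le[OF k n, of d] unfolding m_def of_nat_le_iff .
    show ?thesis
    proof (cases "(k - 1) ^ n \<le> card (relator_words k n)")
      case True
      have "real (num_presentations k n d (proper_subsets_free k)) \<le> (?C - ?P) ^ m"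
        using num True by (simp only: of_nat_power of_nat_diff)
      then have "?g n \<le> (?C - ?P) ^ m / ?C ^ m"
        by (simp add: num_words_def relator_words_def[symmetric] m_def[symmetric] divide_right_mono)
      also have "\<dots> = (1 - ?P / ?C) ^ m"
      proof -
        have "1 - p / c = (c - p) / c" if "c > 0" for c p :: real
          using that by (simp add: field_simps)
        from this[OF C, of ?P] show ?thesis
          by (simp only: power_divide)
      qed
      also have "\<dots> \<le> exp (- (?P / ?C)) ^ m"
      proof (rule power_mono)
        show "1 - ?P / ?C \<le> exp (- (?P / ?C))"
          using exp_ge_add_one_self[of "- (?P / ?C)"] by simp
        have "?P \<le> ?C"
          using True by (metis of_nat_le_iff of_nat_power)
        then show "0 \<le> 1 - ?P / ?C"
          using C by simp
      qed
      also have "\<dots> = exp (- (real m * (?P / ?C)))"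
        by (simp add: exp_of_nat_mult[symmetric])
      also have "\<dots> \<le> exp (- 1)"
        using mP by simp
      finally show ?thesis .
    next
      case False
      \<comment> \<open>In this case the truncated difference is 0, and a positive exponent turns
        the bound into 0.\<close>
      have "m > 0"
        using m by (metis not_gr_zero of_nat_0 zero_less_numeral zero_less_power not_le)
      then have "num_presentations k n d (proper_subsets_free k) = 0"
        using num False by (simp add: zero_power)
      then show ?thesis by simp
    qed
  qed
  then have "\<exists>N. \<forall>n\<ge>N. ?g n \<le> exp (- 1)"
    by (intro exI[of _ 1] allI impI)
  moreover have "?g \<longlonglongrightarrow> 1"
    using rand k unfolding density_random_def low_density_random_def by blast
  ultimately have "1 \<le> exp (- 1 :: real)"
    by (rule LIMSEQ_le_const2[rotated])
  then show False
    by simp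
qed

theorem corollary6p3:
  shows "monotone_low_density_random proper_subsets_free \<and>
    (\<forall>d::real. 0 < d \<and> d < 1 \<longrightarrow> \<not> density_random d proper_subsets_free)"
proof
  show "monotone_low_density_random proper_subsets_free"
    unfolding monotone_low_density_random_def low_density_random_def
    using threshold_density_bounds proper_subsets_free_limit
    by (intro exI[of _ threshold_density]) blast
  show "\<forall>d::real. 0 < d \<and> d < 1 \<longrightarrow> \<not> density_random d proper_subsets_free"
    using not_density_random by blast
qed

end
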